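(* Let $S=(X,\{(V_i,C_i)\}_{i=1}^m)$ be a $k$-ary constraint system and let $\pi$ be a probability distribution on $[m]\times[m]$. Then there is a $P$-homomorphism $\beta:\mathcal{A}_{c-v}(S,\pi')\to\mathcal{A}_{c-c}(S,\pi)$, where $\pi'(i)=\sum_j\pi(i,j)$ and $P=\max_{i,j:\,V_i\cap V_j\ne\varnothing}\frac{\pi'(i)}{\pi(i,j)}$.
   Context: A $k$-ary constraint system is $S=(X,\{(V_i,C_i)\}_{i=1}^m)$ with $X$ a finite set of variables, $V_i\subseteq X$, $C_i\subseteq\mathbb{Z}_k^{V_i}$, $\mathbb{Z}_k=\{0,\dots,k-1\}$; $[m]=\{1,\dots,m\}$. Algebras. $*$-algebras are complex and unital. $\mathbb{C}\mathbb{Z}_k^{*X}$ is the $*$-algebra generated by unitaries $x\in X$ with $x^k=1$; $\mathbb{C}\mathbb{Z}_k^V$ is its abelian analogue. $\Pi_a(x)=\frac1k\sum_{n=0}^{k-1}\omega_k^{-na}x^n$, $\omega_k=e^{2\pi i/k}$; $\Phi_{V,\phi}=\prod_{x\in V}\Pi_{\phi(x)}(x)$ for $\phi\in\mathbb{Z}_k^V$; $\mathcal{A}(V,C)=\mathbb{C}\mathbb{Z}_k^V/\langle\Phi_{V,\phi}:\phi\notin C\rangle$. A weighted $*$-algebra $(\mathcal{A},\mu)$ is a $*$-algebra with a finitely supported weight function $\mu:\mathcal{A}\to[0,\infty)$; below, weights of coinciding listed elements are added, and $\Phi_{V_i,\phi}$ also denotes its image under the inclusion of the $i$th free factor. - $\mathcal{A}_{c-c}(S,\pi)$,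 for $\pi$ a probability distribution on $[m]\times[m]$: the free product of the $\mathcal{A}(V_i,C_i)$, with weight $\pi(i,j)$ on $\Phi_{V_i,\phi}\Phi_{V_j,\psi}$ for $\phi\in C_i,\psi\in C_j$ with $\phi|_{V_i\cap V_j}\ne\psi|_{V_i\cap V_j}$, and $0$ elsewhere. - $\mathcal{A}_{c-v}(S,\pi')$, for $\pi'$ a probability distribution on $[m]$: the free product of all $\mathcal{A}(V_i,C_i)$ and $\mathbb{C}\mathbb{Z}_k^{*X}$ (with inclusion $\sigma'$ of $\mathbb{C}\mathbb{Z}_k^{*X}$), with weight $\pi'(i)/|V_i|$ on $\Phi_{V_i,\phi}(1-\Pi_{\phi(x)}(\sigma'(x)))$ for $i\in[m]$, $x\in V_i$, $\phi\in C_i$, and $0$ elsewhere. $a\lesssim b$ means $b-a=\sum_jc_j^*c_j+\sum_l(f_lg_l-g_lf_l)$ for finitely many elements $c_j,f_l,g_l$. For $C>0$, a $C$-homomorphism $(\mathcal{A},\mu)\to(\mathcal{B},\nu)$ is a $*$-homomorphism $\alpha:\mathcal{A}\to\mathcal{B}$ with $\alpha(\sum_a\mu(a)a^*a)\lesssim C\sum_b\nu(b)b^*b$. For an arbitrary $\pi$, the quantity $P$ can be arbitrarily large.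
   Formalization: The formal theorem assumes P is finite, i.e. π(i,j) > 0 whenever V_i and V_j intersect and π'(i) > 0 (0/0 is read as 0); for other π the ratio defining P divides by zero and a P-homomorphism is undefined. *)

theory Defs
  imports
    "HOL-Probability.Probability_Mass_Function"
    "HOL-Algebra.QuotRing"
    "HOL-Algebra.Module"
begin

section \<open>Complex unital *-algebras\<close>

text \<open>The locale \<open>algebra\<close> of HOL-Algebra is restricted to commutative algebras, hence a locale
  of our own. The zero algebra is allowed: it occurs below as soon as some constraint is
  unsatisfiable.\<close>

record 'a star_alg = "(complex, 'a) module" +
  star :: "'a \<Rightarrow> 'a"

locale star_algebra = ring A for A (structure) +
  assumes smult_closed: "x \<in> carrier A \<Longrightarrow> c \<odot> x \<in> carrier A"
    and smult_l_distr: "x \<in> carrier A \<Longrightarrow> (c + d) \<odot> x = c \<odot> x \<oplus> d \<odot> x"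
    and smult_r_distr: "x \<in> carrier A \<Longrightarrow> y \<in> carrier A \<Longrightarrow> c \<odot> (x \<oplus> y) = c \<odot> x \<oplus> c \<odot> y"
    and smult_assoc: "x \<in> carrier A \<Longrightarrow> (c * d) \<odot> x = c \<odot> (d \<odot> x)"
    and smult_one: "x \<in> carrier A \<Longrightarrow> 1 \<odot> x = x"
    and smult_mult_left: "x \<in> carrier A \<Longrightarrow> y \<in> carrier A \<Longrightarrow> (c \<odot> x) \<otimes> y = c \<odot> (x \<otimes> y)"
    and smult_mult_right: "x \<in> carrier A \<Longrightarrow> y \<in> carrier A \<Longrightarrow> x \<otimes> (c \<odot> y) = c \<odot> (x \<otimes> y)"
    and star_closed: "x \<in> carrier A \<Longrightarrow> star A x \<in> carrier A"
    and star_star: "x \<in> carrier A \<Longrightarrow> star A (star A x) = x"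
    and star_add: "x \<in> carrier A \<Longrightarrow> y \<in> carrier A \<Longrightarrow> star A (x \<oplus> y) = star A x \<oplus> star A y"
    and star_mult: "x \<in> carrier A \<Longrightarrow> y \<in> carrier A \<Longrightarrow> star A (x \<otimes> y) = star A y \<otimes> star A x"
    and star_smult: "x \<in> carrier A \<Longrightarrow> star A (c \<odot> x) = cnj c \<odot> star A x"

definition star_hom :: "('a, 'm) star_alg_scheme \<Rightarrow> ('b, 'n) star_alg_scheme \<Rightarrow> ('a \<Rightarrow> 'b) set" where
  "star_hom A B = {h \<in> ring_hom A B.
     (\<forall>c. \<forall>x\<in>carrier A. h (c \<odot>\<^bsub>A\<^esub> x) = c \<odot>\<^bsub>B\<^esub> h x) \<and>
     (\<forall>x\<in>carrier A. h (star A x) = star B (h x))}"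

text \<open>The relation \<open>a \<lesssim> b\<close>: up to a finite sum of commutators, \<open>b - a\<close> is a finite sum of
  hermitian squares.\<close>

definition sos_tracial_le :: "('a, 'm) star_alg_scheme \<Rightarrow> 'a \<Rightarrow> 'a \<Rightarrow> bool" where
  "sos_tracial_le A a b \<longleftrightarrow>
     (\<exists>(p::nat) (q::nat) c f g.
        c \<in> {..<p} \<rightarrow> carrier A \<and> f \<in> {..<q} \<rightarrow> carrier A \<and> g \<in> {..<q} \<rightarrow> carrier A \<and>
        b \<ominus>\<^bsub>A\<^esub> a =
          (\<Oplus>\<^bsub>A\<^esub>j\<in>{..<p}. star A (c j) \<otimes>\<^bsub>A\<^esub> c j) \<oplus>\<^bsub>A\<^esub>
          (\<Oplus>\<^bsub>A\<^esub>l\<in>{..<q}. f l \<otimes>\<^bsub>A\<^esub> g l \<ominus>\<^bsub>A\<^esub> g l \<otimes>\<^bsub>A\<^esub> f l))"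

subsection \<open>Weighted *-algebras\<close>

locale weighted_star_algebra = star_algebra A for A (structure) and \<mu> :: "'a \<Rightarrow> real" +
  assumes weight_nonneg: "a \<in> carrier A \<Longrightarrow> 0 \<le> \<mu> a"
    and finite_support: "finite {a \<in> carrier A. \<mu> a \<noteq> 0}"

definition weighted_squares :: "('a, 'm) star_alg_scheme \<Rightarrow> ('a \<Rightarrow> real) \<Rightarrow> 'a" where
  "weighted_squares A \<mu> =
     (\<Oplus>\<^bsub>A\<^esub>a\<in>{a \<in> carrier A. \<mu> a \<noteq> 0}. complex_of_real (\<mu> a) \<odot>\<^bsub>A\<^esub> (star A a \<otimes>\<^bsub>A\<^esub> a))"

text \<open>The notion is meant for \<open>K > 0\<close>; stating it for every real \<open>K\<close> gives it a meaning for
  \<open>K = 0\<close> as well, which is the value of \<open>cc_cv_constant\<close> below when every nonempty \<open>V\<^sub>i\<close> has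
  \<open>\<pi>'(i) = 0\<close>. In all other cases that constant is at least \<open>1\<close>, as the pairs \<open>(i, i)\<close>
  show.\<close>

definition C_homomorphism ::
    "real \<Rightarrow> ('a, 'm) star_alg_scheme \<Rightarrow> ('a \<Rightarrow> real) \<Rightarrow>
     ('b, 'n) star_alg_scheme \<Rightarrow> ('b \<Rightarrow> real) \<Rightarrow> ('a \<Rightarrow> 'b) \<Rightarrow> bool" where
  "C_homomorphism K A \<mu> B \<nu> \<alpha> \<longleftrightarrow>
     weighted_star_algebra A \<mu> \<and> weighted_star_algebra B \<nu> \<and> \<alpha> \<in> star_hom A B \<and>
     sos_tracial_le B (\<alpha> (weighted_squares A \<mu>))
       (complex_of_real K \<odot>\<^bsub>B\<^esub> weighted_squares B \<nu>)"

text \<open>The weight function that puts \<open>w t\<close> on the element \<open>e t\<close> for each \<open>t \<in> L\<close>. If several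
  \<open>t\<close> give the same element, their weights are added.\<close>

definition listed_weight :: "'t set \<Rightarrow> ('t \<Rightarrow> real) \<Rightarrow> ('t \<Rightarrow> 'a) \<Rightarrow> 'a \<Rightarrow> real" where
  "listed_weight L w e a = (\<Sum>t | t \<in> L \<and> e t = a. w t)"

section \<open>Generators and relations, free products, quotients\<close>

datatype (gens: 'g) star_term =
    Gen 'g
  | Zero
  | One
  | Plus "'g star_term" "'g star_term"
  | Times "'g star_term" "'g star_term"
  | Scale complex "'g star_term"
  | Star "'g star_term"

text \<open>The least congruence on *-algebra expressions that contains \<open>R\<close> and the laws of unital
  complex *-algebras.\<close>

inductive star_cong :: "('g star_term \<times> 'g star_term) set \<Rightarrow> 'g star_term \<Rightarrow> 'g star_term \<Rightarrow> bool"
  for R where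
  rel: "(s, t) \<in> R \<Longrightarrow> star_cong R s t"
| cong_refl: "star_cong R t t"
| cong_sym: "star_cong R s t \<Longrightarrow> star_cong R t s"
| cong_trans: "star_cong R s t \<Longrightarrow> star_cong R t u \<Longrightarrow> star_cong R s u"
| Plus_cong: "star_cong R s s' \<Longrightarrow> star_cong R t t' \<Longrightarrow> star_cong R (Plus s t) (Plus s' t')"
| Times_cong: "star_cong R s s' \<Longrightarrow> star_cong R t t' \<Longrightarrow> star_cong R (Times s t) (Times s' t')"
| Scale_cong: "star_cong R s s' \<Longrightarrow> star_cong R (Scale c s) (Scale c s')"
| Star_cong: "star_cong R s s' \<Longrightarrow> star_cong R (Star s) (Star s')"
| plus_assoc: "star_cong R (Plus (Plus s t) u) (Plus s (Plus t u))"
| plus_comm: "star_cong R (Plus s t) (Plus t s)"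
| plus_zero: "star_cong R (Plus Zero t) t"
| plus_minus: "star_cong R (Plus t (Scale (-1) t)) Zero"
| times_assoc: "star_cong R (Times (Times s t) u) (Times s (Times t u))"
| one_times: "star_cong R (Times One t) t"
| times_one: "star_cong R (Times t One) t"
| distrib_right: "star_cong R (Times (Plus s t) u) (Plus (Times s u) (Times t u))"
| distrib_left: "star_cong R (Times u (Plus s t)) (Plus (Times u s) (Times u t))"
| scale_add: "star_cong R (Scale (c + d) t) (Plus (Scale c t) (Scale d t))"
| scale_plus: "star_cong R (Scale c (Plus s t)) (Plus (Scale c s) (Scale c t))"
| scale_mult: "star_cong R (Scale (c * d) t) (Scale c (Scale d t))"
| scale_one: "star_cong R (Scale 1 t) t"
| scale_times_left: "star_cong R (Times (Scale c s) t) (Scale c (Times s t))"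
| scale_times_right: "star_cong R (Times s (Scale c t)) (Scale c (Times s t))"
| star_star: "star_cong R (Star (Star t)) t"
| star_plus: "star_cong R (Star (Plus s t)) (Plus (Star s) (Star t))"
| star_times: "star_cong R (Star (Times s t)) (Times (Star t) (Star s))"
| star_scale: "star_cong R (Star (Scale c t)) (Scale (cnj c) (Star t))"

text \<open>The *-algebra with generators \<open>G\<close> and relations \<open>R\<close>; the pairs in \<open>R\<close> should be expressions
  over \<open>G\<close>. The congruence lives on expressions over the whole generator type, but this identifies
  no further expressions over \<open>G\<close>: replacing all other generators by \<open>Zero\<close> respects it.\<close>

definition term_class ::
    "'g set \<Rightarrow> ('g star_term \<times> 'g star_term) set \<Rightarrow> 'g star_term \<Rightarrow> 'g star_term set" where
  "term_class G R t = {s. gens s \<subseteq> G \<and> star_cong R t s}"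

definition presented ::
    "'g set \<Rightarrow> ('g star_term \<times> 'g star_term) set \<Rightarrow> 'g star_term set star_alg" where
  "presented G R = \<lparr>
     carrier = term_class G R ` {t. gens t \<subseteq> G},
     mult = (\<lambda>S T. \<Union>s\<in>S. \<Union>t\<in>T. term_class G R (Times s t)),
     one = term_class G R One,
     zero = term_class G R Zero,
     add = (\<lambda>S T. \<Union>s\<in>S. \<Union>t\<in>T. term_class G R (Plus s t)),
     smult = (\<lambda>c S. \<Union>s\<in>S. term_class G R (Scale c s)),
     star = (\<lambda>S. \<Union>s\<in>S. term_class G R (Star s))\<rparr>"

text \<open>The relations that make \<open>a \<mapsto> e a\<close> a unital *-homomorphism on \<open>A\<close>.\<close>

definition hom_relations ::
    "('a \<Rightarrow> 'g) \<Rightarrow> 'a star_alg \<Rightarrow> ('g star_term \<times> 'g star_term) set" where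
  "hom_relations e A =
     {(Gen (e (a \<oplus>\<^bsub>A\<^esub> b)), Plus (Gen (e a)) (Gen (e b))) | a b. a \<in> carrier A \<and> b \<in> carrier A} \<union>
     {(Gen (e (a \<otimes>\<^bsub>A\<^esub> b)), Times (Gen (e a)) (Gen (e b))) | a b. a \<in> carrier A \<and> b \<in> carrier A} \<union>
     {(Gen (e (c \<odot>\<^bsub>A\<^esub> a)), Scale c (Gen (e a))) | c a. a \<in> carrier A} \<union>
     {(Gen (e (star A a)), Star (Gen (e a))) | a. a \<in> carrier A} \<union>
     {(Gen (e \<one>\<^bsub>A\<^esub>), One)}"

text \<open>The free product of the family \<open>A i\<close> (\<open>i \<in> I\<close>), and the free product of such a family with
  one further algebra \<open>B\<close>, which may have a different element type.\<close>

definition fp_gens :: "'i set \<Rightarrow> ('i \<Rightarrow> 'a star_alg) \<Rightarrow> ('i \<times> 'a) set" where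
  "fp_gens I A = (SIGMA i:I. carrier (A i))"

definition fp_rels ::
    "'i set \<Rightarrow> ('i \<Rightarrow> 'a star_alg) \<Rightarrow> (('i \<times> 'a) star_term \<times> ('i \<times> 'a) star_term) set" where
  "fp_rels I A = (\<Union>i\<in>I. hom_relations (Pair i) (A i))"

definition free_product ::
    "'i set \<Rightarrow> ('i \<Rightarrow> 'a star_alg) \<Rightarrow> ('i \<times> 'a) star_term set star_alg" where
  "free_product I A = presented (fp_gens I A) (fp_rels I A)"

definition fp_incl ::
    "'i set \<Rightarrow> ('i \<Rightarrow> 'a star_alg) \<Rightarrow> 'i \<Rightarrow> 'a \<Rightarrow> ('i \<times> 'a) star_term set" where
  "fp_incl I A i a = term_class (fp_gens I A) (fp_rels I A) (Gen (i, a))"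

definition fpw_gens ::
    "'i set \<Rightarrow> ('i \<Rightarrow> 'a star_alg) \<Rightarrow> 'b star_alg \<Rightarrow> (('i \<times> 'a) + 'b) set" where
  "fpw_gens I A B = (SIGMA i:I. carrier (A i)) <+> carrier B"

definition fpw_rels ::
    "'i set \<Rightarrow> ('i \<Rightarrow> 'a star_alg) \<Rightarrow> 'b star_alg \<Rightarrow>
     ((('i \<times> 'a) + 'b) star_term \<times> (('i \<times> 'a) + 'b) star_term) set" where
  "fpw_rels I A B = (\<Union>i\<in>I. hom_relations (\<lambda>a. Inl (i, a)) (A i)) \<union> hom_relations Inr B"

definition free_product_with ::
    "'i set \<Rightarrow> ('i \<Rightarrow> 'a star_alg) \<Rightarrow> 'b star_alg \<Rightarrow> (('i \<times> 'a) + 'b) star_term set star_alg" where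
  "free_product_with I A B = presented (fpw_gens I A B) (fpw_rels I A B)"

definition fpw_incl ::
    "'i set \<Rightarrow> ('i \<Rightarrow> 'a star_alg) \<Rightarrow> 'b star_alg \<Rightarrow> 'i \<Rightarrow> 'a \<Rightarrow> (('i \<times> 'a) + 'b) star_term set" where
  "fpw_incl I A B i a = term_class (fpw_gens I A B) (fpw_rels I A B) (Gen (Inl (i, a)))"

definition fpw_incl_extra ::
    "'i set \<Rightarrow> ('i \<Rightarrow> 'a star_alg) \<Rightarrow> 'b star_alg \<Rightarrow> 'b \<Rightarrow> (('i \<times> 'a) + 'b) star_term set" where
  "fpw_incl_extra I A B b = term_class (fpw_gens I A B) (fpw_rels I A B) (Gen (Inr b))"

text \<open>\<open>A / J\<close> for a *-closed two-sided ideal \<open>J\<close>: the quotient ring \<open>A Quot J\<close> with the induced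
  scalar multiplication and involution.\<close>

definition star_quot :: "'a star_alg \<Rightarrow> 'a set \<Rightarrow> 'a set star_alg" where
  "star_quot A J = \<lparr>
     carrier = carrier (A Quot J),
     mult = mult (A Quot J),
     one = one (A Quot J),
     zero = zero (A Quot J),
     add = add (A Quot J),
     smult = (\<lambda>c S. \<Union>s\<in>S. J +>\<^bsub>A\<^esub> (c \<odot>\<^bsub>A\<^esub> s)),
     star = (\<lambda>S. \<Union>s\<in>S. J +>\<^bsub>A\<^esub> star A s)\<rparr>"

section \<open>The algebras of a constraint system\<close>

definition cz_rels :: "nat \<Rightarrow> 'x set \<Rightarrow> ('x star_term \<times> 'x star_term) set" where
  "cz_rels k X =
     {(Times (Star (Gen x)) (Gen x), One) | x. x \<in> X} \<union>
     {(Times (Gen x) (Star (Gen x)), One) | x. x \<in> X} \<union>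
     {((Times (Gen x) ^^ k) One, One) | x. x \<in> X}"

definition comm_rels :: "'x set \<Rightarrow> ('x star_term \<times> 'x star_term) set" where
  "comm_rels V = {(Times (Gen x) (Gen y), Times (Gen y) (Gen x)) | x y. x \<in> V \<and> y \<in> V}"

text \<open>\<open>\<complex>\<int>\<^sub>k\<^sup>*\<^sup>X\<close> and \<open>\<complex>\<int>\<^sub>k\<^sup>V\<close>, with their generators.\<close>

definition cz_free :: "nat \<Rightarrow> 'x set \<Rightarrow> 'x star_term set star_alg" where
  "cz_free k X = presented X (cz_rels k X)"

definition cz_free_gen :: "nat \<Rightarrow> 'x set \<Rightarrow> 'x \<Rightarrow> 'x star_term set" where
  "cz_free_gen k X x = term_class X (cz_rels k X) (Gen x)"

definition cz_ab :: "nat \<Rightarrow> 'x set \<Rightarrow> 'x star_term set star_alg" where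
  "cz_ab k V = presented V (cz_rels k V \<union> comm_rels V)"

definition cz_ab_gen :: "nat \<Rightarrow> 'x set \<Rightarrow> 'x \<Rightarrow> 'x star_term set" where
  "cz_ab_gen k V x = term_class V (cz_rels k V \<union> comm_rels V) (Gen x)"

text \<open>\<open>\<Pi>\<^sub>a(u)\<close> for an element \<open>u\<close> of an arbitrary *-algebra.\<close>

definition omega :: "nat \<Rightarrow> complex" where
  "omega k = exp (2 * complex_of_real pi * \<i> / of_nat k)"

definition spec_proj :: "('a, 'm) star_alg_scheme \<Rightarrow> nat \<Rightarrow> nat \<Rightarrow> 'a \<Rightarrow> 'a" where
  "spec_proj A k a u =
     (1 / of_nat k) \<odot>\<^bsub>A\<^esub>
       (\<Oplus>\<^bsub>A\<^esub>n\<in>{..<k}. (omega k powi (- (int n * int a))) \<odot>\<^bsub>A\<^esub> (u [^]\<^bsub>A\<^esub> n))"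

definition Phi_ab :: "nat \<Rightarrow> 'x set \<Rightarrow> ('x \<Rightarrow> nat) \<Rightarrow> 'x star_term set" where
  "Phi_ab k V \<phi> = (\<Otimes>\<^bsub>cz_ab k V\<^esub>x\<in>V. spec_proj (cz_ab k V) k (\<phi> x) (cz_ab_gen k V x))"

text \<open>Elements of \<open>\<int>\<^sub>k\<^sup>V\<close> are extensional functions, so that distinct functions have distinct
  restrictions to \<open>V\<close>. The ideal is generated by self-adjoint elements, hence *-closed.\<close>

definition constraint_ideal :: "nat \<Rightarrow> 'x set \<Rightarrow> ('x \<Rightarrow> nat) set \<Rightarrow> 'x star_term set set" where
  "constraint_ideal k V C = Idl\<^bsub>cz_ab k V\<^esub> (Phi_ab k V ` ((V \<rightarrow>\<^sub>E {..<k}) - C))"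

definition constraint_alg ::
    "nat \<Rightarrow> 'x set \<Rightarrow> ('x \<Rightarrow> nat) set \<Rightarrow> 'x star_term set set star_alg" where
  "constraint_alg k V C = star_quot (cz_ab k V) (constraint_ideal k V C)"

definition Phi :: "nat \<Rightarrow> 'x set \<Rightarrow> ('x \<Rightarrow> nat) set \<Rightarrow> ('x \<Rightarrow> nat) \<Rightarrow> 'x star_term set set" where
  "Phi k V C \<phi> = constraint_ideal k V C +>\<^bsub>cz_ab k V\<^esub> Phi_ab k V \<phi>"

record 'x csystem =
  variables :: "'x set"
  num :: nat
  scope :: "nat \<Rightarrow> 'x set"
  allowed :: "nat \<Rightarrow> ('x \<Rightarrow> nat) set"

definition constraint_system :: "nat \<Rightarrow> 'x csystem \<Rightarrow> bool" where
  "constraint_system k S \<longleftrightarrow>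
     0 < k \<and> finite (variables S) \<and>
     (\<forall>i\<in>{1..num S}. scope S i \<subseteq> variables S \<and> allowed S i \<subseteq> (scope S i \<rightarrow>\<^sub>E {..<k}))"

definition clause_alg :: "nat \<Rightarrow> 'x csystem \<Rightarrow> nat \<Rightarrow> 'x star_term set set star_alg" where
  "clause_alg k S i = constraint_alg k (scope S i) (allowed S i)"

subsection \<open>The constraint-constraint algebra\<close>

type_synonym 'x cc_elem = "(nat \<times> 'x star_term set set) star_term set"

definition cc_alg :: "nat \<Rightarrow> 'x csystem \<Rightarrow> 'x cc_elem star_alg" where
  "cc_alg k S = free_product {1..num S} (clause_alg k S)"

definition cc_Phi :: "nat \<Rightarrow> 'x csystem \<Rightarrow> nat \<Rightarrow> ('x \<Rightarrow> nat) \<Rightarrow> 'x cc_elem" where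
  "cc_Phi k S i \<phi> =
     fp_incl {1..num S} (clause_alg k S) i (Phi k (scope S i) (allowed S i) \<phi>)"

definition cc_weight :: "nat \<Rightarrow> 'x csystem \<Rightarrow> (nat \<times> nat) pmf \<Rightarrow> 'x cc_elem \<Rightarrow> real" where
  "cc_weight k S \<pi> =
     listed_weight
       {(i, j, \<phi>, \<psi>). i \<in> {1..num S} \<and> j \<in> {1..num S} \<and> \<phi> \<in> allowed S i \<and> \<psi> \<in> allowed S j \<and>
          restrict \<phi> (scope S i \<inter> scope S j) \<noteq> restrict \<psi> (scope S i \<inter> scope S j)}
       (\<lambda>(i, j, \<phi>, \<psi>). pmf \<pi> (i, j))
       (\<lambda>(i, j, \<phi>, \<psi>). cc_Phi k S i \<phi> \<otimes>\<^bsub>cc_alg k S\<^esub> cc_Phi k S j \<psi>)"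

subsection \<open>The constraint-variable algebra\<close>

type_synonym 'x cv_elem = "((nat \<times> 'x star_term set set) + 'x star_term set) star_term set"

definition cv_alg :: "nat \<Rightarrow> 'x csystem \<Rightarrow> 'x cv_elem star_alg" where
  "cv_alg k S = free_product_with {1..num S} (clause_alg k S) (cz_free k (variables S))"

definition cv_Phi :: "nat \<Rightarrow> 'x csystem \<Rightarrow> nat \<Rightarrow> ('x \<Rightarrow> nat) \<Rightarrow> 'x cv_elem" where
  "cv_Phi k S i \<phi> =
     fpw_incl {1..num S} (clause_alg k S) (cz_free k (variables S)) i
       (Phi k (scope S i) (allowed S i) \<phi>)"

definition cv_var :: "nat \<Rightarrow> 'x csystem \<Rightarrow> 'x \<Rightarrow> 'x cv_elem" where
  "cv_var k S x =
     fpw_incl_extra {1..num S} (clause_alg k S) (cz_free k (variables S))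
       (cz_free_gen k (variables S) x)"

definition cv_weight :: "nat \<Rightarrow> 'x csystem \<Rightarrow> nat pmf \<Rightarrow> 'x cv_elem \<Rightarrow> real" where
  "cv_weight k S \<pi>' =
     listed_weight
       {(i, x, \<phi>). i \<in> {1..num S} \<and> x \<in> scope S i \<and> \<phi> \<in> allowed S i}
       (\<lambda>(i, x, \<phi>). pmf \<pi>' i / real (card (scope S i)))
       (\<lambda>(i, x, \<phi>). cv_Phi k S i \<phi> \<otimes>\<^bsub>cv_alg k S\<^esub>
          (\<one>\<^bsub>cv_alg k S\<^esub> \<ominus>\<^bsub>cv_alg k S\<^esub> spec_proj (cv_alg k S) k (\<phi> x) (cv_var k S x)))"

text \<open>The constant \<open>P\<close>, as a supremum (of finitely many values) in \<open>[0,\<infinity>]\<close>. There \<open>a / 0 = \<infinity>\<close> for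
  \<open>a > 0\<close> and \<open>0 / 0 = 0\<close>, so \<open>P < \<infinity>\<close> says exactly that \<open>\<pi>(i, j) > 0\<close> whenever
  \<open>V\<^sub>i \<inter> V\<^sub>j \<noteq> {}\<close> and \<open>\<pi>'(i) > 0\<close>. The supremum over no pairs is \<open>0\<close>.\<close>

definition cc_cv_constant :: "'x csystem \<Rightarrow> (nat \<times> nat) pmf \<Rightarrow> nat pmf \<Rightarrow> ennreal" where
  "cc_cv_constant S \<pi> \<pi>' =
     (SUP (i, j) \<in> {(i, j). i \<in> {1..num S} \<and> j \<in> {1..num S} \<and> scope S i \<inter> scope S j \<noteq> {}}.
        ennreal (pmf \<pi>' i) / ennreal (pmf \<pi> (i, j)))"

end

theory Submission
  imports Defs
begin

text \<open>For every variable \<open>x\<close> that occurs in some scope choose an index \<open>r x\<close> with \<open>x \<in> V\<^bsub>r x\<^esub>\<close>. The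
  homomorphism \<open>\<beta>\<close> is the inclusion on each clause algebra and sends \<open>x\<close> to the generator \<open>x\<close> of the
  clause algebra with index \<open>r x\<close>. There the \<open>\<Phi>\<^bsub>r x,\<psi>\<^esub>\<close> with \<open>\<psi> \<in> C\<^bsub>r x\<^esub>\<close> are projections with sum
  \<open>1\<close>, and \<open>\<Pi>\<^sub>a(x)\<close> is the sum of those with \<open>\<psi> x = a\<close>. Hence, up to commutators, the image of
  \<open>\<Phi>\<^bsub>i,\<phi>\<^esub>(1 - \<Pi>\<^bsub>\<phi> x\<^esub>(x))\<close> has as its square the sum over \<open>\<psi>\<close> with \<open>\<psi> x \<noteq> \<phi> x\<close> of the squares of
  \<open>\<Phi>\<^bsub>i,\<phi>\<^esub>\<Phi>\<^bsub>r x,\<psi>\<^esub>\<close>. A fixed product \<open>\<Phi>\<^bsub>i,\<phi>\<^esub>\<Phi>\<^bsub>j,\<psi>\<^esub>\<close> arises from at most \<open>|V\<^sub>i|\<close> variables, each with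
  weight \<open>\<pi>'(i)/|V\<^sub>i|\<close>, and only if \<open>V\<^sub>i \<inter> V\<^sub>j \<noteq> {}\<close>; so its total weight is at most
  \<open>\<pi>'(i) \<le> P \<pi>(i, j)\<close>.\<close>

section \<open>Finite sums and complex *-algebras\<close>

text \<open>What removes the cross terms from the square of a sum is the trace property: for
  projections p and q the square of pq is qpq, which differs from pq by a commutator, so modulo
  commutators it is linear in q. The projection q = 1 - \<Pi> is therefore expanded linearly into
  elements \<Phi>, and each summand is then turned back into a square by the same identity. Clause
  algebras that share a variable are unrelated inside the free product, whereas \<beta> needs one
  image for each variable; this forces a choice of clause. As any clause with an overlapping scope
  may be the chosen one, the ratio has to be bounded for all pairs of overlapping scopes, i = j
  included. The algebras consist of term classes and their cosets, so homomorphisms out of free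
  products and group algebras come from universal properties; the spectral projections are computed
  once, for any unitary with k-th power one in any *-algebra, and then transported.\<close>

context abelian_monoid begin

text \<open>All later rearrangements of finite sums, both the exchange of double sums and the
  addition of weights of coinciding elements, reduce to this one.\<close>

lemma finsum_fibres:
  assumes "finite L" "finite T" "e \<in> L \<rightarrow> T" "f \<in> L \<rightarrow> carrier G"
  shows "(\<Oplus>l\<in>L. f l) = (\<Oplus>t\<in>T. \<Oplus>l\<in>{l\<in>L. e l = t}. f l)"
proof -
  have "L = (\<Union>t\<in>T. {l\<in>L. e l = t})"
    using assms by auto
  moreover have "finsum G f (\<Union>t\<in>T. {l\<in>L. e l = t}) = (\<Oplus>t\<in>T. finsum G f {l\<in>L. e l = t})"
    using assms by (intro add.finprod_UN_disjoint) (auto simp: pairwise_def disjnt_def)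
  ultimately show ?thesis
    by simp
qed

lemma finsum_Sigma:
  assumes "finite A" "\<And>a. a \<in> A \<Longrightarrow> finite (B a)"
    "\<And>a b. a \<in> A \<Longrightarrow> b \<in> B a \<Longrightarrow> f a b \<in> carrier G"
  shows "(\<Oplus>a\<in>A. \<Oplus>b\<in>B a. f a b) = (\<Oplus>p\<in>Sigma A B. case_prod f p)"
proof -
  have "(\<Oplus>p\<in>Sigma A B. case_prod f p) = (\<Oplus>a\<in>A. \<Oplus>p\<in>{p\<in>Sigma A B. fst p = a}. case_prod f p)"
    using assms by (intro finsum_fibres) auto
  also have "\<dots> = (\<Oplus>a\<in>A. \<Oplus>b\<in>B a. f a b)"
  proof (rule finsum_cong')
    fix a assume a: "a \<in> A"
    have "{p\<in>Sigma A B. fst p = a} = Pair a ` B a"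
      using a by auto
    moreover have "(\<Oplus>p\<in>Pair a ` B a. case_prod f p) = (\<Oplus>b\<in>B a. case_prod f (a, b))"
      using assms a by (intro finsum_reindex) (auto simp: inj_on_def)
    ultimately show "(\<Oplus>p\<in>{p\<in>Sigma A B. fst p = a}. case_prod f p) = (\<Oplus>b\<in>B a. f a b)"
      by simp
  qed (use assms in \<open>auto intro!: finsum_closed\<close>)
  finally show ?thesis
    by simp
qed

lemma finsum_swap:
  assumes "finite A" "finite B" "\<And>a b. a \<in> A \<Longrightarrow> b \<in> B \<Longrightarrow> f a b \<in> carrier G"
  shows "(\<Oplus>a\<in>A. \<Oplus>b\<in>B. f a b) = (\<Oplus>b\<in>B. \<Oplus>a\<in>A. f a b)"
proof -
  have "(\<Oplus>a\<in>A. \<Oplus>b\<in>B. f a b) = (\<Oplus>p\<in>A \<times> B. case_prod f p)"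
    using assms by (intro finsum_Sigma) auto
  also have "A \<times> B = prod.swap ` (B \<times> A)"
    by auto
  also have "finsum G (case_prod f) (prod.swap ` (B \<times> A)) = (\<Oplus>p\<in>B \<times> A. case_prod f (prod.swap p))"
    using assms by (intro finsum_reindex) auto
  also have "\<dots> = (\<Oplus>p\<in>B \<times> A. case_prod (\<lambda>b a. f a b) p)"
    by (intro finsum_cong') (use assms in auto)
  also have "\<dots> = (\<Oplus>b\<in>B. \<Oplus>a\<in>A. f a b)"
    using assms by (intro finsum_Sigma[symmetric]) auto
  finally show ?thesis .
qed

end

context star_algebra begin



lemma smult_zero_left: "x \<in> carrier A \<Longrightarrow> 0 \<odot> x = \<zero>"
  using smult_l_distr[of x 0 0] by (metis add.l_cancel_one' add_0 smult_closed)

lemma smult_zero_right: "c \<odot> \<zero> = \<zero>"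
  using smult_r_distr[of \<zero> \<zero> c] by (metis add.l_cancel_one' l_zero smult_closed zero_closed)

lemma smult_minus_one: "x \<in> carrier A \<Longrightarrow> (-1) \<odot> x = \<ominus> x"
  using smult_l_distr[of x "-1" 1] smult_zero_left smult_one minus_equality[of "(-1) \<odot> x" x]
  by (simp add: smult_closed)

lemma smult_minus: "x \<in> carrier A \<Longrightarrow> c \<odot> (\<ominus> x) = \<ominus> (c \<odot> x)"
  by (metis mult.commute smult_assoc smult_closed smult_minus_one)

lemma smult_diff: "x \<in> carrier A \<Longrightarrow> y \<in> carrier A \<Longrightarrow> c \<odot> (x \<ominus> y) = c \<odot> x \<ominus> c \<odot> y"
  by (simp add: minus_eq smult_r_distr smult_minus)

lemma smult_finsum:
  "f \<in> I \<rightarrow> carrier A \<Longrightarrow> c \<odot> (\<Oplus>i\<in>I. f i) = (\<Oplus>i\<in>I. c \<odot> f i)"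
  by (induction I rule: infinite_finite_induct)
     (auto simp: smult_zero_right smult_r_distr smult_closed Pi_def finsum_closed)

lemma finsum_smult_left:
  assumes "x \<in> carrier A" "finite I"
  shows "(\<Oplus>i\<in>I. c i \<odot> x) = (\<Sum>i\<in>I. c i) \<odot> x"
  using assms(2,1)
  by (induction I rule: finite_induct) (auto simp: smult_zero_left smult_l_distr smult_closed)

lemma star_zero: "star A \<zero> = \<zero>"
  using star_smult[of \<zero> 0] by (simp add: smult_zero_left star_closed)

text \<open>The locale does not postulate this: an involution that reverses products is onto, so it
  maps the unit to a unit.\<close>

lemma star_one: "star A \<one> = \<one>"
  by (metis one_closed l_one r_one star_closed star_mult star_star)

lemma star_finsum:
  "f \<in> I \<rightarrow> carrier A \<Longrightarrow> star A (\<Oplus>i\<in>I. f i) = (\<Oplus>i\<in>I. star A (f i))"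
  by (induction I rule: infinite_finite_induct)
     (auto simp: star_zero star_add star_closed Pi_def finsum_closed)

lemma star_diff: "x \<in> carrier A \<Longrightarrow> y \<in> carrier A \<Longrightarrow> star A (x \<ominus> y) = star A x \<ominus> star A y"
  using star_smult[of y "-1"]
  by (simp add: minus_eq star_add smult_minus_one star_closed)



text \<open>No law is assumed for \<open>B\<close>: all of them are inherited along a surjection
  that respects the operations. This is how quotients become *-algebras.\<close>

lemma star_algebra_image:
  fixes B :: "('c, 'd) star_alg_scheme" (structure)
  assumes B: "carrier B = q ` carrier A"
    and add: "\<And>x y. x \<in> carrier A \<Longrightarrow> y \<in> carrier A \<Longrightarrow> q x \<oplus>\<^bsub>B\<^esub> q y = q (x \<oplus> y)"
    and mult: "\<And>x y. x \<in> carrier A \<Longrightarrow> y \<in> carrier A \<Longrightarrow> q x \<otimes>\<^bsub>B\<^esub> q y = q (x \<otimes> y)"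
    and zero: "\<zero>\<^bsub>B\<^esub> = q \<zero>" and one: "\<one>\<^bsub>B\<^esub> = q \<one>"
    and smult: "\<And>c x. x \<in> carrier A \<Longrightarrow> c \<odot>\<^bsub>B\<^esub> q x = q (c \<odot> x)"
    and star: "\<And>x. x \<in> carrier A \<Longrightarrow> star B (q x) = q (star A x)"
  shows "star_algebra B" "q \<in> star_hom A B"
proof -
  have "abelian_group B"
  proof (rule abelian_groupI)
    fix x assume "x \<in> carrier B"
    then obtain a where a: "a \<in> carrier A" "x = q a"
      using B by auto
    then show "\<exists>y\<in>carrier B. y \<oplus>\<^bsub>B\<^esub> x = \<zero>\<^bsub>B\<^esub>"
      using B by (intro bexI[of _ "q (\<ominus> a)"]) (auto simp: add zero l_neg)
  qed (auto simp: B add zero a_ac)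
  moreover have "Group.monoid B"
    by (rule monoidI) (auto simp: B mult one m_assoc)
  ultimately have "ring B"
    by (rule ringI) (auto simp: B add mult l_distr r_distr)
  then show "star_algebra B"
    by (intro star_algebra.intro star_algebra_axioms.intro)
       (auto simp: B smult mult add star smult_closed smult_l_distr smult_r_distr smult_assoc
         smult_one smult_mult_left smult_mult_right star_closed star_star star_add star_mult star_smult)
  show "q \<in> star_hom A B"
    by (auto simp: star_hom_def ring_hom_def B add mult one smult star)
qed

end

section \<open>*-homomorphisms\<close>

locale star_alg_hom = A?: star_algebra A + B?: star_algebra B
  for A (structure) and B (structure) +
  fixes h
  assumes star_hom: "h \<in> star_hom A B"
begin

lemma hom_ring: "h \<in> ring_hom A B"
  using star_hom by (simp add: star_hom_def)

sublocale ring_hom_ring A B h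
  by (rule ring_hom_ringI2) (auto simp: hom_ring A.ring_axioms B.ring_axioms)

lemma hom_smult: "x \<in> carrier A \<Longrightarrow> h (c \<odot>\<^bsub>A\<^esub> x) = c \<odot>\<^bsub>B\<^esub> h x"
  using star_hom by (simp add: star_hom_def)

lemma hom_star: "x \<in> carrier A \<Longrightarrow> h (star A x) = star B (h x)"
  using star_hom by (simp add: star_hom_def)

lemma hom_finsum: "f \<in> I \<rightarrow> carrier A \<Longrightarrow> h (finsum A f I) = finsum B (\<lambda>i. h (f i)) I"
  by (induction I rule: infinite_finite_induct) (auto simp: Pi_def A.finsum_closed)

lemma hom_diff: "x \<in> carrier A \<Longrightarrow> y \<in> carrier A \<Longrightarrow> h (x \<ominus>\<^bsub>A\<^esub> y) = h x \<ominus>\<^bsub>B\<^esub> h y"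
  by (simp add: A.minus_eq B.minus_eq)

lemma hom_nat_pow: "x \<in> carrier A \<Longrightarrow> h (x [^]\<^bsub>A\<^esub> n) = h x [^]\<^bsub>B\<^esub> (n::nat)"
  by (induction n) auto

lemma hom_spec_proj:
  assumes "u \<in> carrier A"
  shows "h (spec_proj A k a u) = spec_proj B k a (h u)"
proof -
  have "h (\<Oplus>\<^bsub>A\<^esub>n\<in>{..<k}. (omega k powi (- (int n * int a))) \<odot>\<^bsub>A\<^esub> (u [^]\<^bsub>A\<^esub> n)) =
    (\<Oplus>\<^bsub>B\<^esub>n\<in>{..<k}. h ((omega k powi (- (int n * int a))) \<odot>\<^bsub>A\<^esub> (u [^]\<^bsub>A\<^esub> n)))"
    using assms by (intro hom_finsum) (auto intro!: A.smult_closed)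
  also have "\<dots> = (\<Oplus>\<^bsub>B\<^esub>n\<in>{..<k}. (omega k powi (- (int n * int a))) \<odot>\<^bsub>B\<^esub> (h u [^]\<^bsub>B\<^esub> n))"
    using assms by (intro B.finsum_cong') (auto simp: hom_smult hom_nat_pow intro!: B.smult_closed)
  finally show ?thesis
    using assms by (simp add: spec_proj_def hom_smult A.finsum_closed A.smult_closed Pi_def)
qed

end

section \<open>Algebras given by generators and relations\<close>

lemma term_class_eqI: "star_cong R s t \<Longrightarrow> term_class G R s = term_class G R t"
  unfolding term_class_def by (blast intro: cong_sym cong_trans)

lemma term_class_self: "gens t \<subseteq> G \<Longrightarrow> t \<in> term_class G R t"
  by (simp add: term_class_def cong_refl)

text \<open>Operations on classes and cosets are written as unions over representatives. Such a
  union is a single class as soon as there is a representative and all of them give the same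
  result.\<close>

lemma UN_const_eq: "I \<noteq> {} \<Longrightarrow> (\<And>i. i \<in> I \<Longrightarrow> F i = Y) \<Longrightarrow> (\<Union>i\<in>I. F i) = Y"
  by auto

lemma term_class_nonempty: "gens t \<subseteq> G \<Longrightarrow> term_class G R t \<noteq> {}"
  using term_class_self by blast

lemma term_class_cong: "t' \<in> term_class G R t \<Longrightarrow> star_cong R t' t"
  by (simp add: term_class_def cong_sym)

lemma presented_carrier: "carrier (presented G R) = term_class G R ` {t. gens t \<subseteq> G}"
  by (simp add: presented_def)

lemma term_class_closed [intro]: "gens t \<subseteq> G \<Longrightarrow> term_class G R t \<in> carrier (presented G R)"
  by (auto simp: presented_carrier)

lemma presented_one: "\<one>\<^bsub>presented G R\<^esub> = term_class G R One"
  and presented_zero: "\<zero>\<^bsub>presented G R\<^esub> = term_class G R Zero"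
  by (simp_all add: presented_def)

lemma presented_mult:
  assumes "gens s \<subseteq> G" "gens t \<subseteq> G"
  shows "term_class G R s \<otimes>\<^bsub>presented G R\<^esub> term_class G R t = term_class G R (Times s t)"
  unfolding presented_def using assms
  by (auto intro!: UN_const_eq term_class_nonempty term_class_eqI Times_cong intro: term_class_cong)

lemma presented_add:
  assumes "gens s \<subseteq> G" "gens t \<subseteq> G"
  shows "term_class G R s \<oplus>\<^bsub>presented G R\<^esub> term_class G R t = term_class G R (Plus s t)"
  unfolding presented_def using assms
  by (auto intro!: UN_const_eq term_class_nonempty term_class_eqI Plus_cong intro: term_class_cong)

lemma presented_smult:
  assumes "gens t \<subseteq> G"
  shows "c \<odot>\<^bsub>presented G R\<^esub> term_class G R t = term_class G R (Scale c t)"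
  unfolding presented_def using assms
  by (auto intro!: UN_const_eq term_class_nonempty term_class_eqI Scale_cong intro: term_class_cong)

lemma presented_star:
  assumes "gens t \<subseteq> G"
  shows "star (presented G R) (term_class G R t) = term_class G R (Star t)"
  unfolding presented_def using assms
  by (auto intro!: UN_const_eq term_class_nonempty term_class_eqI Star_cong intro: term_class_cong)

lemmas presented_ops = presented_one presented_zero presented_mult presented_add
  presented_smult presented_star



lemma presented_star_algebra: "star_algebra (presented G R)"
proof -
  let ?A = "presented G R"
  have "abelian_group ?A"
  proof (rule abelian_groupI)
    fix x assume "x \<in> carrier ?A"
    then obtain t where t: "gens t \<subseteq> G" "x = term_class G R t"
      by (auto simp: presented_carrier)
    have "term_class G R (Scale (-1) t) \<oplus>\<^bsub>?A\<^esub> x = \<zero>\<^bsub>?A\<^esub>"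
      using t by (auto simp: presented_ops intro!: term_class_eqI cong_trans[OF plus_comm plus_minus])
    then show "\<exists>y\<in>carrier ?A. y \<oplus>\<^bsub>?A\<^esub> x = \<zero>\<^bsub>?A\<^esub>"
      using t by (intro bexI[of _ "term_class G R (Scale (-1) t)"] term_class_closed) auto
  \<comment> \<open>Each remaining law is a clause of \<open>star_cong\<close>; an equation between
    classes has to be reduced to that congruence and not split into two inclusions of sets.\<close>
  qed (auto simp: presented_carrier presented_ops
        del: equalityI intro!: term_class_eqI plus_assoc plus_comm plus_zero imageI)
  moreover have "Group.monoid ?A"
    by (rule monoidI) (auto simp: presented_carrier presented_ops
        del: equalityI intro!: term_class_eqI times_assoc one_times times_one imageI)
  ultimately have "ring ?A"
    by (rule ringI) (auto simp: presented_carrier presented_ops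
        del: equalityI intro!: term_class_eqI distrib_left distrib_right)
  then show ?thesis
    by (intro star_algebra.intro star_algebra_axioms.intro)
       (auto simp: presented_carrier presented_ops
         del: equalityI intro!: term_class_eqI imageI scale_add scale_plus scale_mult scale_one scale_times_left
           scale_times_right star_cong.star_star star_plus star_times star_scale)
qed

text \<open>Structural induction on representing terms, phrased for elements of the algebra; it
  serves to pass from commutation with generators to commutation with everything.\<close>

lemma presented_induct [consumes 1, case_names gen zero one add mult smult star]:
  assumes x: "x \<in> carrier (presented G R)"
    and gen: "\<And>g. g \<in> G \<Longrightarrow> P (term_class G R (Gen g))"
    and zero: "P \<zero>\<^bsub>presented G R\<^esub>" and one: "P \<one>\<^bsub>presented G R\<^esub>"
    and add: "\<And>x y. x \<in> carrier (presented G R) \<Longrightarrow> y \<in> carrier (presented G R) \<Longrightarrow>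
      P x \<Longrightarrow> P y \<Longrightarrow> P (x \<oplus>\<^bsub>presented G R\<^esub> y)"
    and mult: "\<And>x y. x \<in> carrier (presented G R) \<Longrightarrow> y \<in> carrier (presented G R) \<Longrightarrow>
      P x \<Longrightarrow> P y \<Longrightarrow> P (x \<otimes>\<^bsub>presented G R\<^esub> y)"
    and smult: "\<And>c x. x \<in> carrier (presented G R) \<Longrightarrow> P x \<Longrightarrow> P (c \<odot>\<^bsub>presented G R\<^esub> x)"
    and star: "\<And>x. x \<in> carrier (presented G R) \<Longrightarrow> P x \<Longrightarrow> P (star (presented G R) x)"
  shows "P x"
proof -
  have "P (term_class G R t)" if "gens t \<subseteq> G" for t
    using that
  proof (induction t)
    case Zero then show ?case using zero by (simp add: presented_zero)
  next
    case One then show ?case using one by (simp add: presented_one)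
  next
    case (Plus s t)
    then show ?case
      using add[of "term_class G R s" "term_class G R t"] by (auto simp: presented_add)
  next
    case (Times s t)
    then show ?case
      using mult[of "term_class G R s" "term_class G R t"] by (auto simp: presented_mult)
  next
    case (Scale c t)
    then show ?case
      using smult[of "term_class G R t" c] by (auto simp: presented_smult)
  next
    case (Star t)
    then show ?case
      using star[of "term_class G R t"] by (auto simp: presented_star)
  qed (auto intro: gen)
  then show ?thesis
    using x by (auto simp: presented_carrier)
qed

primrec term_eval :: "('a, 'm) star_alg_scheme \<Rightarrow> ('g \<Rightarrow> 'a) \<Rightarrow> 'g star_term \<Rightarrow> 'a" where
  "term_eval B f (Gen g) = f g"
| "term_eval B f Zero = \<zero>\<^bsub>B\<^esub>"
| "term_eval B f One = \<one>\<^bsub>B\<^esub>"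
| "term_eval B f (Plus s t) = term_eval B f s \<oplus>\<^bsub>B\<^esub> term_eval B f t"
| "term_eval B f (Times s t) = term_eval B f s \<otimes>\<^bsub>B\<^esub> term_eval B f t"
| "term_eval B f (Scale c s) = c \<odot>\<^bsub>B\<^esub> term_eval B f s"
| "term_eval B f (Star s) = star B (term_eval B f s)"

lemma term_eval_cong: "(\<And>g. g \<in> gens t \<Longrightarrow> f g = f' g) \<Longrightarrow> term_eval B f t = term_eval B f' t"
  by (induction t) auto

lemma (in star_algebra) term_eval_closed: "range f \<subseteq> carrier A \<Longrightarrow> term_eval A f t \<in> carrier A"
  by (induction t) (auto simp: smult_closed star_closed)

text \<open>Every clause of the congruence is a law of *-algebras. The whole range of
  \<open>f\<close> must lie in the carrier, because transitivity may pass through terms with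
  generators that occur at neither end.\<close>

lemma (in star_algebra) term_eval_star_cong:
  assumes f: "range f \<subseteq> carrier A"
    and R: "\<And>s t. (s, t) \<in> R \<Longrightarrow> term_eval A f s = term_eval A f t"
  shows "star_cong R s t \<Longrightarrow> term_eval A f s = term_eval A f t"
proof (induction rule: star_cong.induct)
  case (plus_minus t)
  then show ?case
    by (simp add: smult_minus_one r_neg term_eval_closed[OF f])
qed (simp_all add: R term_eval_closed[OF f] a_ac m_assoc l_distr r_distr smult_closed
      smult_l_distr smult_r_distr smult_assoc smult_one smult_mult_left smult_mult_right star_closed
      star_star star_add star_mult star_smult)

text \<open>Relations may only involve generators from \<open>G\<close>; the extension of \<open>f\<close> by \<open>\<zero>\<close> to all other
  generators then still respects them.\<close>

lemma (in star_algebra) presented_universal: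
  assumes f: "f \<in> G \<rightarrow> carrier A"
    and R: "\<And>s t. (s, t) \<in> R \<Longrightarrow> gens s \<subseteq> G \<and> gens t \<subseteq> G \<and> term_eval A f s = term_eval A f t"
  obtains h where "h \<in> star_hom (presented G R) A" "\<And>g. g \<in> G \<Longrightarrow> h (term_class G R (Gen g)) = f g"
proof -
  define f' where "f' g = (if g \<in> G then f g else \<zero>)" for g
  define h where "h X = term_eval A f' (SOME t. t \<in> X)" for X
  have f': "range f' \<subseteq> carrier A"
    using f by (auto simp: f'_def)
  have f'_eq: "term_eval A f' t = term_eval A f t" if "gens t \<subseteq> G" for t
    using that by (intro term_eval_cong) (auto simp: f'_def)
  have "term_eval A f' s = term_eval A f' t" if "star_cong R s t" for s t
    using that by (rule term_eval_star_cong[OF f', rotated]) (use R in \<open>auto simp: f'_eq\<close>)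
  then have h: "h (term_class G R t) = term_eval A f' t" if "gens t \<subseteq> G" for t
    unfolding h_def using someI[of "\<lambda>s. s \<in> term_class G R t", OF term_class_self[OF that]]
    by (auto dest: term_class_cong)
  show thesis
  proof
    show "h \<in> star_hom (presented G R) A"
      by (auto simp: star_hom_def ring_hom_def presented_carrier presented_ops h term_eval_closed[OF f'])
    show "h (term_class G R (Gen g)) = f g" if "g \<in> G" for g
      using that by (simp add: h f'_def)
  qed
qed

section \<open>Quotients and free products\<close>


lemma star_quot_star_algebra:
  fixes A :: "'a star_alg" (structure)
  assumes "star_algebra A" "ideal J A" and star_J: "\<And>x. x \<in> J \<Longrightarrow> star A x \<in> J"
  shows "star_algebra (star_quot A J)" "(+>) J \<in> star_hom A (star_quot A J)"
    "carrier (star_quot A J) = (+>) J ` carrier A"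
proof -
  interpret star_algebra A by fact
  interpret ideal J A by fact
  \<comment> \<open>A ring ideal is automatically a subspace, since a scalar acts as multiplication
    by a multiple of the unit.\<close>
  have smult_J: "c \<odot> x \<in> J" if "x \<in> J" for c x
  proof -
    have "c \<odot> x = (c \<odot> \<one>) \<otimes> x"
      using that by (simp add: smult_mult_left a_Hcarr)
    then show ?thesis
      using that by (simp add: I_l_closed smult_closed)
  qed
  have coset_eq: "J +> y = J +> x" if "y = j \<oplus> x" "j \<in> J" "x \<in> carrier A" for x y j
    using that by (intro a_repr_independence'[symmetric]) (auto simp: a_r_coset_def')
  show carrier: "carrier (star_quot A J) = (+>) J ` carrier A"
    by (auto simp: star_quot_def FactRing_simps)
  have coset_mem: "\<exists>j\<in>J. s = j \<oplus> x" if "s \<in> J +> x" for s x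
    using that by (auto simp: a_r_coset_def')
  have smult: "c \<odot>\<^bsub>star_quot A J\<^esub> (J +> x) = J +> (c \<odot> x)" if x: "x \<in> carrier A" for c x
  proof -
    have "J +> (c \<odot> s) = J +> (c \<odot> x)" if "s \<in> J +> x" for s
    proof -
      obtain j where "j \<in> J" "s = j \<oplus> x"
        using coset_mem \<open>s \<in> J +> x\<close> by blast
      with x show ?thesis
        by (intro coset_eq[of _ "c \<odot> j"]) (simp_all add: smult_r_distr a_Hcarr smult_J smult_closed)
    qed
    moreover have "J +> x \<noteq> {}"
      using a_rcos_self[OF x] by blast
    ultimately show ?thesis
      by (simp add: star_quot_def UN_const_eq)
  qed
  have star: "star (star_quot A J) (J +> x) = J +> star A x" if x: "x \<in> carrier A" for x
  proof -
    have "J +> star A s = J +> star A x" if "s \<in> J +> x" for s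
    proof -
      obtain j where "j \<in> J" "s = j \<oplus> x"
        using coset_mem \<open>s \<in> J +> x\<close> by blast
      with x show ?thesis
        by (intro coset_eq[of _ "star A j"]) (simp_all add: star_add a_Hcarr star_J star_closed)
    qed
    moreover have "J +> x \<noteq> {}"
      using a_rcos_self[OF x] by blast
    ultimately show ?thesis
      by (simp add: star_quot_def UN_const_eq)
  qed
  \<comment> \<open>The zero of the quotient ring is by definition the set \<open>J\<close>; this
    identifies it with the coset of zero.\<close>
  have J: "J = J +> \<zero>"
    using a_coset_add_zero[OF a_subset] by simp
  note * = carrier _ _ _ _ smult star
  show "star_algebra (star_quot A J)" "(+>) J \<in> star_hom A (star_quot A J)"
    by (rule star_algebra_image[OF *];
        simp add: star_quot_def FactRing_def rcoset_mult_add a_rcos_sum flip: J)+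
qed

text \<open>The members of the ideal whose adjoint is also a member form an ideal, as the adjoint
  merely exchanges left and right multiplication. It contains \<open>S\<close>, so minimality of the
  generated ideal applies.\<close>

lemma (in star_algebra) genideal_star_closed:
  assumes S: "S \<subseteq> carrier A" "\<And>x. x \<in> S \<Longrightarrow> star A x = x" and "x \<in> Idl S"
  shows "star A x \<in> Idl S"
proof -
  interpret I: ideal "Idl S" A
    by (rule genideal_ideal[OF S(1)])
  let ?I = "{x \<in> Idl S. star A x \<in> Idl S}"
  have "ideal ?I A"
  proof (rule idealI)
    show "subgroup ?I (add_monoid A)"
    proof (rule add.subgroupI)
      fix x assume "x \<in> ?I"
      then show "\<ominus> x \<in> ?I"
        using star_diff[of \<zero> x] by (auto simp: minus_eq star_zero star_closed)
    next
      have "\<zero> \<in> ?I"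
        by (simp add: star_zero)
      then show "?I \<noteq> {}"
        by blast
    qed (auto simp: star_add)
  qed (auto simp: ring_axioms star_mult I.I_l_closed I.I_r_closed star_closed)
  moreover have "S \<subseteq> ?I"
    using genideal_self[OF S(1)] S(2) by auto
  ultimately have "Idl S \<subseteq> ?I"
    by (rule genideal_minimal)
  then show ?thesis
    using assms(3) by auto
qed

section \<open>Inclusions into free products and their universal property\<close>

lemma hom_relations_star_hom:
  assumes "star_algebra A" and e: "e \<in> carrier A \<rightarrow> G" and R: "hom_relations e A \<subseteq> R"
  shows "(\<lambda>a. term_class G R (Gen (e a))) \<in> star_hom A (presented G R)"
proof -
  interpret star_algebra A by fact
  have e': "gens (Gen (e a)) \<subseteq> G" if "a \<in> carrier A" for a
    using e that by auto
  have "star_cong R s t" if "(s, t) \<in> hom_relations e A" for s t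
    using that R by (auto intro: rel)
  then have "term_class G R s = term_class G R t" if "(s, t) \<in> hom_relations e A" for s t
    using that by (auto del: equalityI intro!: term_class_eqI)
  note eq = this[unfolded hom_relations_def]
  have "term_class G R (Gen (e (a \<oplus>\<^bsub>A\<^esub> b))) = term_class G R (Plus (Gen (e a)) (Gen (e b)))"
    "term_class G R (Gen (e (a \<otimes>\<^bsub>A\<^esub> b))) = term_class G R (Times (Gen (e a)) (Gen (e b)))"
    "term_class G R (Gen (e (c \<odot>\<^bsub>A\<^esub> a))) = term_class G R (Scale c (Gen (e a)))"
    "term_class G R (Gen (e (star A a))) = term_class G R (Star (Gen (e a)))"
    "term_class G R (Gen (e \<one>\<^bsub>A\<^esub>)) = term_class G R One"
    if "a \<in> carrier A" "b \<in> carrier A" for a b c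
    using that by (intro eq; blast)+
  \<comment> \<open>The five equations were derived together for two elements \<open>a\<close> and
    \<open>b\<close>; zero fills the places of those that an equation does not mention.\<close>
  note hom = this(1,2) this(3,4)[OF _ zero_closed] this(5)[OF zero_closed zero_closed]
  show ?thesis
    using e' by (auto simp: star_hom_def ring_hom_def presented_ops hom)
qed

text \<open>Converse direction: a *-homomorphism satisfies the relations imposed on the generators.
  The claim about \<open>gens\<close> is included because \<open>presented_universal\<close> asks
  for it together with the equation.\<close>

lemma hom_relations_eval:
  assumes "star_algebra A" and e: "e \<in> carrier A \<rightarrow> G" and f: "f \<circ> e \<in> star_hom A B"
    and st: "(s, t) \<in> hom_relations e A"
  shows "gens s \<subseteq> G \<and> gens t \<subseteq> G \<and> term_eval B f s = term_eval B f t"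
proof -
  interpret star_algebra A by fact
  have e: "e a \<in> G" if "a \<in> carrier A" for a
    using e that by auto
  have f: "f (e (a \<oplus>\<^bsub>A\<^esub> b)) = f (e a) \<oplus>\<^bsub>B\<^esub> f (e b)" "f (e (a \<otimes>\<^bsub>A\<^esub> b)) = f (e a) \<otimes>\<^bsub>B\<^esub> f (e b)"
    "f (e (c \<odot>\<^bsub>A\<^esub> a)) = c \<odot>\<^bsub>B\<^esub> f (e a)" "f (e (star A a)) = star B (f (e a))" "f (e \<one>\<^bsub>A\<^esub>) = \<one>\<^bsub>B\<^esub>"
    if "a \<in> carrier A" "b \<in> carrier A" for a b c
    using f that by (simp_all add: star_hom_def ring_hom_def)
  show ?thesis
    using st
    by (auto simp: hom_relations_def e f(1,2) f(3,4)[OF _ zero_closed] f(5)[OF zero_closed zero_closed]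
        smult_closed star_closed)
qed

lemma fp_incl_star_hom:
  assumes "i \<in> I" "star_algebra (A i)"
  shows "fp_incl I A i \<in> star_hom (A i) (free_product I A)"
  unfolding fp_incl_def[abs_def] free_product_def
  using assms by (intro hom_relations_star_hom) (auto simp: fp_gens_def fp_rels_def)

lemma fpw_incl_star_hom:
  assumes "i \<in> I" "star_algebra (A i)"
  shows "fpw_incl I A B i \<in> star_hom (A i) (free_product_with I A B)"
  unfolding fpw_incl_def[abs_def] free_product_with_def
  using assms by (intro hom_relations_star_hom) (auto simp: fpw_gens_def fpw_rels_def)

lemma fpw_incl_extra_star_hom:
  assumes "star_algebra B"
  shows "fpw_incl_extra I A B \<in> star_hom B (free_product_with I A B)"
  unfolding fpw_incl_extra_def[abs_def] free_product_with_def
  using assms by (intro hom_relations_star_hom) (auto simp: fpw_gens_def fpw_rels_def)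

text \<open>Existence half of the universal property of a coproduct. Each defining relation stems
  from a single factor, so it can be checked with the homomorphism given on that factor.\<close>

lemma free_product_with_universal:
  assumes "star_algebra D" and A: "\<And>i. i \<in> I \<Longrightarrow> star_algebra (A i)" and B: "star_algebra B"
    and g: "\<And>i. i \<in> I \<Longrightarrow> g i \<in> star_hom (A i) D" and g': "g' \<in> star_hom B D"
  obtains h where "h \<in> star_hom (free_product_with I A B) D"
    "\<And>i a. i \<in> I \<Longrightarrow> a \<in> carrier (A i) \<Longrightarrow> h (fpw_incl I A B i a) = g i a"
    "\<And>b. b \<in> carrier B \<Longrightarrow> h (fpw_incl_extra I A B b) = g' b"
proof -
  interpret D: star_algebra D by fact
  define f where "f = case_sum (case_prod g) g'"
  have "f \<in> fpw_gens I A B \<rightarrow> carrier D"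
    using g g' by (fastforce simp: f_def fpw_gens_def star_hom_def dest: ring_hom_closed)
  moreover have "gens s \<subseteq> fpw_gens I A B \<and> gens t \<subseteq> fpw_gens I A B \<and> term_eval D f s = term_eval D f t"
    if "(s, t) \<in> fpw_rels I A B" for s t
  proof -
    consider i where "i \<in> I" "(s, t) \<in> hom_relations (\<lambda>a. Inl (i, a)) (A i)"
      | "(s, t) \<in> hom_relations Inr B"
      using \<open>(s, t) \<in> fpw_rels I A B\<close> by (auto simp: fpw_rels_def)
    then show ?thesis
    proof cases
      case 1
      moreover have "f \<circ> (\<lambda>a. Inl (i, a)) = g i"
        by (auto simp: f_def)
      ultimately show ?thesis
        using A g by (intro hom_relations_eval[where A = "A i"]) (auto simp: fpw_gens_def)
    next
      case 2
      moreover have "f \<circ> Inr = g'"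
        by (auto simp: f_def)
      ultimately show ?thesis
        using B g' by (intro hom_relations_eval[where A = B]) (auto simp: fpw_gens_def)
    qed
  qed
  ultimately obtain h where h: "h \<in> star_hom (free_product_with I A B) D"
    "\<And>g. g \<in> fpw_gens I A B \<Longrightarrow> h (term_class (fpw_gens I A B) (fpw_rels I A B) (Gen g)) = f g"
    using D.presented_universal[of f "fpw_gens I A B" "fpw_rels I A B"]
    unfolding free_product_with_def by blast
  show thesis
  proof (rule that[OF h(1)])
    show "h (fpw_incl I A B i a) = g i a" if "i \<in> I" "a \<in> carrier (A i)" for i a
      unfolding fpw_incl_def using that by (subst h(2)) (auto simp: fpw_gens_def f_def)
    show "h (fpw_incl_extra I A B b) = g' b" if "b \<in> carrier B" for b
      unfolding fpw_incl_extra_def using that by (subst h(2)) (auto simp: fpw_gens_def f_def)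
  qed
qed

section \<open>Group algebras of cyclic groups\<close>

text \<open>The three equations for \<open>u\<close> are those of \<open>cz_rels\<close>, so these
  are the possible images of a generator of \<open>cz_free\<close>.\<close>

locale cyclic_unitary = star_algebra A for A (structure) +
  fixes k :: nat and u
  assumes k_pos: "0 < k" and u_closed [simp]: "u \<in> carrier A"
    and star_u: "star A u \<otimes> u = \<one>" and u_star: "u \<otimes> star A u = \<one>" and u_pow: "u [^] k = \<one>"

lemma (in star_algebra) cyclic_unitary_one: "0 < k \<Longrightarrow> cyclic_unitary A k \<one>"
  by unfold_locales (auto simp: star_one)

lemma (in cyclic_unitary) cyclic_unitary_image:
  assumes "star_algebra B" "h \<in> star_hom A B"
  shows "cyclic_unitary B k (h u)"
proof -
  interpret B: star_algebra B by fact
  interpret star_alg_hom A B h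
    by unfold_locales fact
  have "h (star A u \<otimes> u) = h \<one>" "h (u \<otimes> star A u) = h \<one>" "h (u [^] k) = h \<one>"
    by (simp_all add: star_u u_star u_pow)
  then show ?thesis
    by unfold_locales (simp_all add: k_pos hom_star hom_nat_pow star_closed)
qed

lemma gens_power: "gens ((Times (Gen x) ^^ n) One) \<subseteq> {x}"
  by (induction n) auto

text \<open>The term adds new factors on the left while \<open>[^]\<close> adds them on the right;
  \<open>nat_pow_Suc2\<close> mediates.\<close>

lemma (in star_algebra) term_eval_power:
  "f x \<in> carrier A \<Longrightarrow> term_eval A f ((Times (Gen x) ^^ n) One) = f x [^] n"
  by (induction n) (simp_all flip: nat_pow_Suc2)

lemma cz_free_universal:
  assumes "star_algebra D" and u: "\<And>x. x \<in> X \<Longrightarrow> cyclic_unitary D k (u x)"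
  obtains h where "h \<in> star_hom (cz_free k X) D" "\<And>x. x \<in> X \<Longrightarrow> h (cz_free_gen k X x) = u x"
proof -
  interpret D: star_algebra D by fact
  note u' = u[THEN cyclic_unitary.u_closed] u[THEN cyclic_unitary.star_u]
    u[THEN cyclic_unitary.u_star] u[THEN cyclic_unitary.u_pow]
  have gens: "gens ((Times (Gen x) ^^ k) One) \<subseteq> X" if "x \<in> X" for x
    using gens_power that by fast
  have "gens s \<subseteq> X \<and> gens t \<subseteq> X \<and> term_eval D u s = term_eval D u t"
    if st: "(s, t) \<in> cz_rels k X" for s t
  proof -
    obtain x where x: "x \<in> X" and "(s, t) \<in> {(Times (Star (Gen x)) (Gen x), One),
        (Times (Gen x) (Star (Gen x)), One), ((Times (Gen x) ^^ k) One, One)}"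
      using st unfolding cz_rels_def by blast
    then show ?thesis
      using gens[OF x] by (auto simp: u'[OF x] D.term_eval_power)
  qed
  moreover have "u \<in> X \<rightarrow> carrier D"
    using u by (auto intro: cyclic_unitary.u_closed)
  ultimately obtain h where "h \<in> star_hom (presented X (cz_rels k X)) D"
    "\<And>x. x \<in> X \<Longrightarrow> h (term_class X (cz_rels k X) (Gen x)) = u x"
    using D.presented_universal[of u X "cz_rels k X"] by blast
  then show thesis
    by (intro that) (auto simp: cz_free_def cz_free_gen_def)
qed

lemma presented_power:
  "x \<in> G \<Longrightarrow> term_class G R (Gen x) [^]\<^bsub>presented G R\<^esub> n = term_class G R ((Times (Gen x) ^^ n) One)"
proof (induction n)
  case 0
  interpret star_algebra "presented G R" by (rule presented_star_algebra)
  show ?case by (simp add: presented_one)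
next
  case (Suc n)
  interpret star_algebra "presented G R" by (rule presented_star_algebra)
  have "gens ((Times (Gen x) ^^ n) One) \<subseteq> G"
    using Suc.prems gens_power by fastforce
  then show ?case
    using Suc by (subst nat_pow_Suc2) (auto simp: presented_mult)
qed

lemma presented_cyclic_unitary:
  assumes "0 < k" "x \<in> G" "cz_rels k G \<subseteq> R"
  shows "cyclic_unitary (presented G R) k (term_class G R (Gen x))"
proof -
  interpret star_algebra "presented G R" by (rule presented_star_algebra)
  have R: "(Times (Star (Gen x)) (Gen x), One) \<in> R" "(Times (Gen x) (Star (Gen x)), One) \<in> R"
    "((Times (Gen x) ^^ k) One, One) \<in> R"
    using assms(2,3) by (auto simp: cz_rels_def)
  note eq = R[THEN rel, THEN term_class_eqI]
  show ?thesis
    using assms(1,2) by unfold_locales (auto simp: presented_power presented_ops eq)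
qed

lemma cz_free_star_algebra: "star_algebra (cz_free k X)"
  and cz_ab_star_algebra: "star_algebra (cz_ab k V)"
  by (simp_all add: cz_free_def cz_ab_def presented_star_algebra)

lemma cz_free_gen_cyclic_unitary:
  "0 < k \<Longrightarrow> x \<in> X \<Longrightarrow> cyclic_unitary (cz_free k X) k (cz_free_gen k X x)"
  and cz_ab_gen_cyclic_unitary:
  "0 < k \<Longrightarrow> x \<in> V \<Longrightarrow> cyclic_unitary (cz_ab k V) k (cz_ab_gen k V x)"
  by (auto simp: cz_free_def cz_free_gen_def cz_ab_def cz_ab_gen_def intro!: presented_cyclic_unitary)

section \<open>Commutativity of the abelian group algebra\<close>

lemma (in cyclic_unitary) commute_star:
  assumes "y \<in> carrier A" "u \<otimes> y = y \<otimes> u"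
  shows "star A u \<otimes> y = y \<otimes> star A u"
proof -
  \<comment> \<open>The adjoint of \<open>u\<close> is its inverse: the commutation relation is
    multiplied by it on both sides.\<close>
  have "star A u \<otimes> y = star A u \<otimes> (y \<otimes> u) \<otimes> star A u"
    using assms(1) by (simp add: m_assoc u_star star_closed)
  also have "\<dots> = star A u \<otimes> u \<otimes> y \<otimes> star A u"
    using assms by (simp add: m_assoc star_closed)
  finally show ?thesis
    using assms(1) by (simp add: star_u star_closed)
qed

text \<open>The adjoint of \<open>y\<close> is carried along because \<open>y\<close> commutes with
  the adjoint of an element exactly when the adjoint of \<open>y\<close> commutes with the element
  itself; without it the induction step for adjoints would fail.\<close>

lemma presented_commute:
  fixes A (structure)
  assumes A: "A = presented G R" and x: "x \<in> carrier (presented G R)" and y: "y \<in> carrier A"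
    and gen: "\<And>g. g \<in> G \<Longrightarrow> y \<otimes> term_class G R (Gen g) = term_class G R (Gen g) \<otimes> y"
    and gen_star: "\<And>g. g \<in> G \<Longrightarrow>
      star A y \<otimes> term_class G R (Gen g) = term_class G R (Gen g) \<otimes> star A y"
  shows "y \<otimes> x = x \<otimes> y"
proof -
  interpret star_algebra A
    unfolding A by (rule presented_star_algebra)
  have "y \<otimes> x = x \<otimes> y \<and> star A y \<otimes> x = x \<otimes> star A y"
    using x
  proof (induction rule: presented_induct)
    case (mult a b)
    note ab = mult[folded A]
    have "z \<otimes> (a \<otimes> b) = a \<otimes> b \<otimes> z"
      if "z \<in> carrier A" "z \<otimes> a = a \<otimes> z" "z \<otimes> b = b \<otimes> z" for z
    proof -
      have "z \<otimes> (a \<otimes> b) = (a \<otimes> z) \<otimes> b"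
        using ab that by (simp flip: m_assoc)
      also have "\<dots> = a \<otimes> (b \<otimes> z)"
        using ab that(1,3) by (simp add: m_assoc)
      finally show ?thesis
        using ab that(1) by (simp add: m_assoc)
    qed
    then show ?case
      unfolding A[symmetric] using ab y star_closed by blast
  next
    case (star a)
    note a = star[folded A]
    have "star A (star A y \<otimes> a) = star A (a \<otimes> star A y)" "star A (y \<otimes> a) = star A (a \<otimes> y)"
      using a by simp_all
    then show ?case
      unfolding A[symmetric] using a(1) y by (simp add: star_mult star_closed star_star)
  next
    case (add a b)
    then show ?case
      unfolding A[symmetric] using y by (simp add: star_closed l_distr r_distr)
  next
    case (smult c a)
    then show ?case
      unfolding A[symmetric] using y by (simp add: star_closed smult_mult_left smult_mult_right)
  next
    case (gen g)
    then show ?case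
      using assms(4,5) by simp
  qed (use y in \<open>simp_all add: star_closed flip: A\<close>)
  then show ?thesis ..
qed

text \<open>The relations only make generators commute with generators. Two passes of
  \<open>presented_commute\<close> extend this, first to a generator and an arbitrary element, then
  to two arbitrary elements; \<open>commute_star\<close> supplies the adjoints of
  generators.\<close>

lemma cz_ab_cring:
  assumes k: "0 < k"
  shows "cring (cz_ab k V)"
proof -
  let ?A = "cz_ab k V"
  interpret star_algebra ?A by (rule cz_ab_star_algebra)
  note commute = presented_commute[OF cz_ab_def, folded cz_ab_gen_def cz_ab_def]
  have gen_commute: "cz_ab_gen k V x \<otimes>\<^bsub>?A\<^esub> cz_ab_gen k V y = cz_ab_gen k V y \<otimes>\<^bsub>?A\<^esub> cz_ab_gen k V x"
    if "x \<in> V" "y \<in> V" for x y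
    using that unfolding cz_ab_def cz_ab_gen_def
    by (auto simp: presented_mult comm_rels_def del: equalityI intro!: term_class_eqI rel)
  have gen_commute': "cz_ab_gen k V x \<otimes>\<^bsub>?A\<^esub> y = y \<otimes>\<^bsub>?A\<^esub> cz_ab_gen k V x"
    if "x \<in> V" "y \<in> carrier ?A" for x y
  proof -
    interpret x: cyclic_unitary ?A k "cz_ab_gen k V x"
      using k that by (intro cz_ab_gen_cyclic_unitary)
    have "cz_ab_gen k V z \<in> carrier ?A" if "z \<in> V" for z
      using cz_ab_gen_cyclic_unitary[OF k that] by (rule cyclic_unitary.u_closed)
    note gen_closed = this
    show ?thesis
    proof (rule commute)
      fix g assume "g \<in> V"
      then show "cz_ab_gen k V x \<otimes>\<^bsub>?A\<^esub> cz_ab_gen k V g = cz_ab_gen k V g \<otimes>\<^bsub>?A\<^esub> cz_ab_gen k V x"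
        by (rule gen_commute[OF \<open>x \<in> V\<close>])
      then show "star ?A (cz_ab_gen k V x) \<otimes>\<^bsub>?A\<^esub> cz_ab_gen k V g =
          cz_ab_gen k V g \<otimes>\<^bsub>?A\<^esub> star ?A (cz_ab_gen k V x)"
        by (rule x.commute_star[OF gen_closed[OF \<open>g \<in> V\<close>]])
    qed (use that x.u_closed in blast)+
  qed
  have "x \<otimes>\<^bsub>?A\<^esub> y = y \<otimes>\<^bsub>?A\<^esub> x" if "x \<in> carrier ?A" "y \<in> carrier ?A" for x y
  proof -
    have "star ?A x \<in> carrier ?A"
      using that star_closed by simp
    show ?thesis
    proof (rule commute)
      fix g assume g: "g \<in> V"
      show "x \<otimes>\<^bsub>?A\<^esub> cz_ab_gen k V g = cz_ab_gen k V g \<otimes>\<^bsub>?A\<^esub> x"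
        "star ?A x \<otimes>\<^bsub>?A\<^esub> cz_ab_gen k V g = cz_ab_gen k V g \<otimes>\<^bsub>?A\<^esub> star ?A x"
        by (rule gen_commute'[OF g, symmetric]; fact)+
    qed fact+
  qed
  then show ?thesis
    by (intro cring.intro comm_monoid.intro comm_monoid_axioms.intro ring_axioms is_monoid)
qed

section \<open>Spectral projections\<close>

locale star_projection = star_algebra A for A (structure) +
  fixes p
  assumes proj_closed [simp]: "p \<in> carrier A" and proj_star: "star A p = p" and proj_idem: "p \<otimes> p = p"

text \<open>The product of an element with its adjoint is self-adjoint, so the single equation
  yields self-adjointness first and idempotence after that.\<close>

lemma (in star_algebra) star_projectionI:
  assumes p: "p \<in> carrier A" and eq: "star A p \<otimes> p = p"
  shows "star_projection A p"
proof -
  have "star A p = star A (star A p \<otimes> p)"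
    by (simp add: eq)
  also have "\<dots> = p"
    using p eq by (subst star_mult) (simp_all add: star_closed star_star)
  finally have "star A p = p" .
  with p eq show ?thesis
    by unfold_locales auto
qed

lemma (in star_projection) star_projection_image:
  assumes "star_algebra B" "h \<in> star_hom A B"
  shows "star_projection B (h p)"
proof -
  interpret B: star_algebra B by fact
  interpret star_alg_hom A B h
    by unfold_locales fact
  have "h (star A p) = h p" "h (p \<otimes> p) = h p"
    by (simp_all add: proj_star proj_idem)
  then show ?thesis
    by unfold_locales (simp_all add: hom_star)
qed

lemma (in star_projection) star_projection_complement: "star_projection A (\<one> \<ominus> p)"
proof
  show "(\<one> \<ominus> p) \<otimes> (\<one> \<ominus> p) = \<one> \<ominus> p"
    by (simp add: minus_eq l_distr r_distr l_minus r_minus proj_idem a_assoc r_neg)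
qed (simp_all add: star_diff star_one proj_star)

section \<open>Roots of unity and character sums\<close>

lemma omega_nonzero: "omega k \<noteq> 0"
  by (simp add: omega_def)



text \<open>This says that \<open>omega k\<close> is a primitive k-th root of unity; it rests on the
  kernel of the exponential being the integer multiples of 2 \<pi> i.\<close>

lemma omega_powi_eq_one_iff:
  assumes "0 < k"
  shows "omega k powi m = 1 \<longleftrightarrow> int k dvd m"
proof -
  have "omega k powi m = exp (2 * of_real pi * \<i> * of_int m / of_nat k)"
    by (simp add: omega_def exp_power_int mult_ac)
  also have "\<dots> = 1 \<longleftrightarrow> (\<exists>n::int. pi * (2 * of_int m / of_nat k) = pi * (2 * of_int n))"
    by (simp add: exp_eq_1 mult_ac)
  also have "\<dots> \<longleftrightarrow> (\<exists>n::int. of_int m / of_nat k = (of_int n :: real))"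
    by (simp only: mult_cancel_left times_divide_eq_right[symmetric]) simp
  also have "\<dots> \<longleftrightarrow> (\<exists>n. m = n * int k)"
  proof -
    have "of_int m / of_nat k = (of_int n :: real) \<longleftrightarrow> m = n * int k" for n
    proof -
      have "of_int m / of_nat k = (of_int n :: real) \<longleftrightarrow> real_of_int m = real_of_int (n * int k)"
        using assms by (simp add: field_simps)
      then show ?thesis
        by (simp only: of_int_eq_iff)
    qed
    then show ?thesis by simp
  qed
  finally show ?thesis
    by (auto simp: dvd_def mult.commute)
qed

lemma cnj_omega_powi: "cnj (omega k) powi (- m) = omega k powi m"
proof -
  have "cnj (omega k) = inverse (omega k)"
    by (simp add: omega_def exp_cnj flip: exp_minus)
  then show ?thesis
    by (simp add: power_int_inverse power_int_minus)
qed

text \<open>Orthogonality of characters: a geometric sum whose ratio has k-th power one vanishes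
  unless the ratio is one.\<close>

lemma sum_omega_powi:
  assumes "0 < k"
  shows "(\<Sum>n<k. omega k powi (int n * m)) = (if int k dvd m then of_nat k else 0)"
proof -
  have eq: "omega k powi (int n * m) = (omega k powi m) ^ n" for n
    by (simp add: mult.commute power_int_mult)
  have "((omega k powi m) ^ k) = 1"
    using omega_powi_eq_one_iff[OF assms, of "m * int k"] by (simp add: power_int_mult)
  then show ?thesis
    using omega_powi_eq_one_iff[OF assms, of m] by (auto simp: eq sum_gp_strict)
qed

context cyclic_unitary begin

abbreviation "proj a \<equiv> spec_proj A k a u"

lemma spec_proj_closed [simp]: "proj a \<in> carrier A"
  by (auto simp: spec_proj_def intro!: smult_closed finsum_closed)

text \<open>Multiplication by \<open>u\<close> shifts the summation index by one and costs the
  factor \<open>omega k powi int a\<close>; the shift is cyclic because \<open>u\<close> and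
  \<open>omega k\<close> both have k-th power one.\<close>

lemma u_spec_proj: "u \<otimes> proj a = (omega k powi int a) \<odot> proj a"
proof -
  define F where "F n = (omega k powi (- (int n * int a))) \<odot> u [^] n" for n :: nat
  have F: "F n \<in> carrier A" for n
    by (simp add: F_def smult_closed)
  have step: "u \<otimes> F n = (omega k powi int a) \<odot> F (Suc n)" for n
  proof -
    have "u \<otimes> u [^] n = u [^] Suc n"
      by (rule nat_pow_Suc2[symmetric]) simp
    moreover have "omega k powi int a * omega k powi (- (int (Suc n) * int a)) =
        omega k powi (- (int n * int a))"
      by (subst power_int_add[symmetric]) (auto simp: omega_nonzero algebra_simps)
    ultimately show ?thesis
      by (simp add: F_def smult_mult_right smult_assoc[symmetric] del: nat_pow_Suc)
  qed
  \<comment> \<open>Wrap-around of the shift. Splitting the sum over \<open>{..<Suc k}\<close> at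
    its last and at its first term, and cancelling these equal terms, shows that shifting leaves the
    sum unchanged.\<close>
  have "F k = F 0"
  proof -
    have "omega k powi (- (int k * int a)) = 1"
      using omega_powi_eq_one_iff[OF k_pos] by simp
    then show ?thesis
      by (simp add: F_def u_pow)
  qed
  moreover have "(\<Oplus>n\<in>{..<Suc k}. F n) = F k \<oplus> (\<Oplus>n\<in>{..<k}. F n)"
    using F by (subst lessThan_Suc) (simp add: Pi_def)
  moreover have "(\<Oplus>n\<in>{..<Suc k}. F n) = F 0 \<oplus> (\<Oplus>n\<in>{..<k}. F (Suc n))"
    using F by (subst lessThan_Suc_eq_insert_0) (simp add: Pi_def finsum_reindex)
  ultimately have shift: "(\<Oplus>n\<in>{..<k}. F (Suc n)) = (\<Oplus>n\<in>{..<k}. F n)"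
    using F by (simp add: finsum_closed Pi_def)
  have "u \<otimes> proj a = (1 / of_nat k) \<odot> (\<Oplus>n\<in>{..<k}. u \<otimes> F n)"
    unfolding spec_proj_def F_def[symmetric]
    using F by (simp add: smult_mult_right finsum_closed finsum_rdistr Pi_def)
  also have "(\<Oplus>n\<in>{..<k}. u \<otimes> F n) = (omega k powi int a) \<odot> (\<Oplus>n\<in>{..<k}. F n)"
    using F by (simp add: step shift flip: smult_finsum)
  finally show ?thesis
    unfolding spec_proj_def F_def[symmetric]
    using F by (simp add: smult_assoc[symmetric] finsum_closed Pi_def mult.commute)
qed

lemma star_u_spec_proj: "star A u \<otimes> proj a = (omega k powi (- int a)) \<odot> proj a"
proof -
  have "proj a = star A u \<otimes> (u \<otimes> proj a)"
    by (simp add: star_closed star_u flip: m_assoc)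
  also have "\<dots> = (omega k powi int a) \<odot> (star A u \<otimes> proj a)"
    by (simp add: u_spec_proj smult_mult_right star_closed)
  finally have "(omega k powi (- int a)) \<odot> proj a =
      (omega k powi (- int a)) \<odot> ((omega k powi int a) \<odot> (star A u \<otimes> proj a))"
    by simp
  then show ?thesis
    by (simp add: smult_assoc[symmetric] star_closed smult_one omega_nonzero power_int_minus)
qed

lemma u_pow_spec_proj: "u [^] n \<otimes> proj a = (omega k powi (int n * int a)) \<odot> proj a"
proof (induction n)
  case (Suc n)
  have "u [^] Suc n \<otimes> proj a = (omega k powi int a) \<odot> (u [^] n \<otimes> proj a)"
    by (simp add: m_assoc u_spec_proj smult_mult_right)
  then show ?case
    by (simp add: Suc smult_assoc[symmetric] algebra_simps omega_nonzero power_int_add)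
qed (simp add: smult_one)

lemma star_u_pow_spec_proj:
  "star A (u [^] n) \<otimes> proj a = (omega k powi (- (int n * int a))) \<odot> proj a"
proof (induction n)
  case (Suc n)
  have "star A (u [^] Suc n) \<otimes> proj a = star A u \<otimes> (star A (u [^] n) \<otimes> proj a)"
    by (simp add: star_mult m_assoc star_closed)
  also have "\<dots> = (omega k powi (- (int n * int a))) \<odot> (star A u \<otimes> proj a)"
    by (simp add: Suc smult_mult_right star_closed)
  finally show ?case
    by (simp add: star_u_spec_proj smult_assoc[symmetric] algebra_simps omega_nonzero
        power_int_diff power_int_minus field_simps power_int_add)
qed (simp add: smult_one star_one)

text \<open>Every power of \<open>u\<close> acts on \<open>proj a\<close> by a scalar, so expanding
  \<open>proj b\<close> leaves a character sum with exponent a - b. The bounds make a - b divisible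
  by k only for a = b.\<close>

lemma spec_proj_mult:
  assumes "a < k" "b < k"
  shows "proj b \<otimes> proj a = (if a = b then proj a else \<zero>)"
proof -
  have "proj b \<otimes> proj a =
      (1 / of_nat k) \<odot> (\<Oplus>n\<in>{..<k}. (omega k powi (- (int n * int b))) \<odot> (u [^] n \<otimes> proj a))"
    unfolding spec_proj_def[of _ _ b]
    by (simp add: smult_mult_left finsum_closed finsum_ldistr Pi_def smult_closed)
  also have "(\<Oplus>n\<in>{..<k}. (omega k powi (- (int n * int b))) \<odot> (u [^] n \<otimes> proj a)) =
      (\<Oplus>n\<in>{..<k}. (omega k powi (int n * (int a - int b))) \<odot> proj a)"
    by (intro finsum_cong')
       (auto simp: u_pow_spec_proj smult_assoc[symmetric] smult_closed omega_nonzero right_diff_distrib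
         power_int_diff power_int_minus field_simps)
  also have "\<dots> = (if a = b then of_nat k else 0) \<odot> proj a"
  proof -
    have "int k dvd int a - int b \<longleftrightarrow> a = b"
      using assms by (simp flip: mod_eq_dvd_iff zmod_int)
    then show ?thesis
      by (simp add: finsum_smult_left sum_omega_powi k_pos)
  qed
  finally show ?thesis
    using k_pos by (auto simp: smult_assoc[symmetric] smult_one smult_zero_left)
qed

text \<open>The phases in the adjoint of \<open>proj a\<close> cancel the scalars by which the
  adjoint powers of \<open>u\<close> act on \<open>proj a\<close>, leaving k equal summands.\<close>

lemma star_projection_spec_proj: "star_projection A (proj a)"
proof (rule star_projectionI)
  have "star A (proj a) = (1 / of_nat k) \<odot>
      (\<Oplus>n\<in>{..<k}. (omega k powi (int n * int a)) \<odot> star A (u [^] n))"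
    unfolding spec_proj_def
    by (simp add: star_smult star_finsum finsum_closed Pi_def smult_closed cnj_omega_powi)
  then have "star A (proj a) \<otimes> proj a = (1 / of_nat k) \<odot>
      (\<Oplus>n\<in>{..<k}. (omega k powi (int n * int a)) \<odot> (star A (u [^] n) \<otimes> proj a))"
    by (simp add: smult_mult_left finsum_closed finsum_ldistr Pi_def smult_closed star_closed)
  also have "(\<Oplus>n\<in>{..<k}. (omega k powi (int n * int a)) \<odot> (star A (u [^] n) \<otimes> proj a)) =
      (\<Oplus>n\<in>{..<k}. 1 \<odot> proj a)"
    by (intro finsum_cong')
       (auto simp: star_u_pow_spec_proj smult_assoc[symmetric] smult_closed omega_nonzero
         simp flip: power_int_add)
  also have "\<dots> = of_nat k \<odot> proj a"
    by (subst finsum_smult_left) simp_all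
  finally show "star A (proj a) \<otimes> proj a = proj a"
    using k_pos by (simp add: smult_assoc[symmetric] smult_one)
qed simp

text \<open>After exchanging the sums, the character sum over \<open>a\<close> kills every power of
  \<open>u\<close> except the zeroth.\<close>

lemma finsum_spec_proj: "(\<Oplus>a\<in>{..<k}. proj a) = \<one>"
proof -
  let ?c = "1 / of_nat k :: complex"
  have "(\<Oplus>a\<in>{..<k}. proj a) =
      ?c \<odot> (\<Oplus>a\<in>{..<k}. \<Oplus>n\<in>{..<k}. (omega k powi (- (int n * int a))) \<odot> (u [^] n))"
    unfolding spec_proj_def
    by (rule smult_finsum[symmetric]) (auto intro!: finsum_closed smult_closed)
  also have "(\<Oplus>a\<in>{..<k}. \<Oplus>n\<in>{..<k}. (omega k powi (- (int n * int a))) \<odot> (u [^] n)) =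
      (\<Oplus>n\<in>{..<k}. \<Oplus>a\<in>{..<k}. (omega k powi (- (int n * int a))) \<odot> (u [^] n))"
    by (rule finsum_swap) (auto simp: smult_closed)
  also have "\<dots> = (\<Oplus>n\<in>{..<k}. if 0 = n then of_nat k \<odot> u [^] n else \<zero>)"
  proof (rule finsum_cong')
    fix n assume n: "n \<in> {..<k}"
    have "(\<Oplus>a\<in>{..<k}. (omega k powi (- (int n * int a))) \<odot> (u [^] n)) =
        (\<Sum>a<k. omega k powi (int a * (- int n))) \<odot> (u [^] n)"
      by (subst finsum_smult_left) (simp_all add: mult.commute)
    also have "(\<Sum>a<k. omega k powi (int a * (- int n))) = (if 0 = n then of_nat k else 0)"
      using n sum_omega_powi[OF k_pos, of "- int n"] by (auto dest: zdvd_imp_le)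
    finally show "(\<Oplus>a\<in>{..<k}. (omega k powi (- (int n * int a))) \<odot> (u [^] n)) =
        (if 0 = n then of_nat k \<odot> u [^] n else \<zero>)"
      by (simp add: smult_zero_left)
  qed (auto simp: smult_closed)
  also have "\<dots> = of_nat k \<odot> u [^] (0::nat)"
    using k_pos by (intro add.finprod_singleton) (auto simp: smult_closed)
  finally show ?thesis
    using k_pos by (simp add: smult_assoc[symmetric] smult_one)
qed

end

section \<open>Constraint algebras\<close>

text \<open>Distributivity: expanding the product over \<open>x\<close> of sums that are all one
  gives one summand for each choice function. The induction splits off the value at the new
  point.\<close>

lemma (in cring) finsum_PiE_finprod_eq_one:
  assumes "finite V" "finite B"
    and p: "\<And>x a. x \<in> V \<Longrightarrow> a \<in> B \<Longrightarrow> p x a \<in> carrier R"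
    and one: "\<And>x. x \<in> V \<Longrightarrow> (\<Oplus>a\<in>B. p x a) = \<one>"
  shows "(\<Oplus>\<psi>\<in>V \<rightarrow>\<^sub>E B. \<Otimes>x\<in>V. p x (\<psi> x)) = \<one>"
  using assms(1) p one
proof (induction V rule: finite_induct)
  case empty
  then show ?case
    by (simp add: PiE_empty_domain)
next
  case (insert y V)
  let ?ext = "\<lambda>(a, \<psi>). \<psi>(y := a)"
  let ?F = "\<lambda>\<psi>. \<Otimes>x\<in>V. p x (\<psi> x)"
  have F: "?F \<psi> \<in> carrier R" if "\<psi> \<in> V \<rightarrow>\<^sub>E B" for \<psi>
    using that insert.prems(1) by (intro finprod_closed) (auto simp: PiE_def Pi_def)
  have finite: "finite (V \<rightarrow>\<^sub>E B)"
    using insert.hyps(1) assms(2) by (simp add: finite_PiE)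
  have prod: "(\<Otimes>x\<in>insert y V. p x ((\<psi>(y := a)) x)) = p y a \<otimes> ?F \<psi>"
    if "a \<in> B" "\<psi> \<in> V \<rightarrow>\<^sub>E B" for a \<psi>
  proof -
    \<comment> \<open>The update at \<open>y\<close> is invisible here, since \<open>y\<close> lies
      outside \<open>V\<close>.\<close>
    have "(\<Otimes>x\<in>V. p x ((\<psi>(y := a)) x)) = ?F \<psi>"
      using that insert by (intro finprod_cong') (auto simp: PiE_def Pi_def)
    moreover have "(\<lambda>x. p x ((\<psi>(y := a)) x)) \<in> V \<rightarrow> carrier R"
      using that insert by (auto simp: PiE_def Pi_def)
    ultimately show ?thesis
      using that insert by (subst finprod_insert) auto
  qed
  have "(\<Oplus>\<psi>\<in>insert y V \<rightarrow>\<^sub>E B. \<Otimes>x\<in>insert y V. p x (\<psi> x)) =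
      (\<Oplus>z\<in>B \<times> (V \<rightarrow>\<^sub>E B). \<Otimes>x\<in>insert y V. p x (?ext z x))"
    unfolding PiE_insert_eq
  proof (rule finsum_reindex)
    show "(\<lambda>\<psi>. \<Otimes>x\<in>insert y V. p x (\<psi> x)) \<in> ?ext ` (B \<times> (V \<rightarrow>\<^sub>E B)) \<rightarrow> carrier R"
      using F prod insert.prems(1) by (auto simp del: fun_upd_apply)
    show "inj_on ?ext (B \<times> (V \<rightarrow>\<^sub>E B))"
      using inj_combinator[OF insert.hyps(2), of "\<lambda>_. B"] by simp
  qed
  also have "\<dots> = (\<Oplus>z\<in>B \<times> (V \<rightarrow>\<^sub>E B). case_prod (\<lambda>a \<psi>. p y a \<otimes> ?F \<psi>) z)"
    using insert.prems(1) F by (intro finsum_cong') (auto simp del: fun_upd_apply simp: prod)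
  also have "\<dots> = (\<Oplus>a\<in>B. \<Oplus>\<psi>\<in>V \<rightarrow>\<^sub>E B. p y a \<otimes> ?F \<psi>)"
    using insert.prems(1) F assms(2) finite by (intro finsum_Sigma[symmetric]) auto
  also have "\<dots> = (\<Oplus>a\<in>B. p y a \<otimes> (\<Oplus>\<psi>\<in>V \<rightarrow>\<^sub>E B. ?F \<psi>))"
    using insert.prems(1) F finite by (intro finsum_cong' finsum_rdistr[symmetric]) (auto intro!: finsum_closed)
  also have "(\<Oplus>\<psi>\<in>V \<rightarrow>\<^sub>E B. ?F \<psi>) = \<one>"
    using insert.IH insert.prems by blast
  also have "(\<Oplus>a\<in>B. p y a \<otimes> \<one>) = (\<Oplus>a\<in>B. p y a)"
    using insert.prems(1) by (intro finsum_cong') auto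
  finally show ?case
    using insert.prems(2) by simp
qed

lemma star_projection_finprod:
  assumes "cring A" "finite I" and p: "\<And>i. i \<in> I \<Longrightarrow> star_projection A (p i)" and "star_algebra A"
  shows "star_projection A (finprod A p I)"
  using assms(2) p
proof (induction I rule: finite_induct)
  case empty
  interpret star_algebra A by fact
  interpret cring A by fact
  show ?case
    by (rule star_projectionI) (simp_all add: star_one)
next
  case (insert i I)
  interpret cring A by fact
  interpret pi: star_projection A "p i"
    using insert.prems by simp
  interpret P: star_projection A "finprod A p I"
    using insert by simp
  have p: "p \<in> I \<rightarrow> carrier A"
    using insert.prems by (auto intro: star_projection.proj_closed)
  have "star A (p i \<otimes>\<^bsub>A\<^esub> finprod A p I) \<otimes>\<^bsub>A\<^esub> (p i \<otimes>\<^bsub>A\<^esub> finprod A p I) =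
      (p i \<otimes>\<^bsub>A\<^esub> p i) \<otimes>\<^bsub>A\<^esub> (finprod A p I \<otimes>\<^bsub>A\<^esub> finprod A p I)"
    by (simp add: pi.star_mult pi.proj_star P.proj_star m_ac)
  then have "star_projection A (p i \<otimes>\<^bsub>A\<^esub> finprod A p I)"
    by (intro pi.star_projectionI) (simp_all add: pi.proj_idem P.proj_idem)
  then show ?case
    using insert.hyps p by simp
qed

locale constraint_data =
  fixes k :: nat and V :: "'x set" and C :: "('x \<Rightarrow> nat) set"
  assumes k_pos: "0 < k" and finite_V: "finite V" and C: "C \<subseteq> V \<rightarrow>\<^sub>E {..<k}"
begin

abbreviation "ab \<equiv> cz_ab k V"
abbreviation "E \<equiv> constraint_alg k V C"
abbreviation "J \<equiv> constraint_ideal k V C"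
abbreviation "q x a \<equiv> spec_proj ab k a (cz_ab_gen k V x)"

lemma cyclic_unitary_gen: "x \<in> V \<Longrightarrow> cyclic_unitary ab k (cz_ab_gen k V x)"
  using k_pos by (rule cz_ab_gen_cyclic_unitary)

sublocale ab: star_algebra ab
  by (rule cz_ab_star_algebra)

sublocale ab: cring ab
  using k_pos by (rule cz_ab_cring)

lemma q_closed: "x \<in> V \<Longrightarrow> q x a \<in> carrier ab"
  using cyclic_unitary.spec_proj_closed[OF cyclic_unitary_gen] .

lemma star_projection_Phi_ab: "star_projection ab (Phi_ab k V \<psi>)"
  unfolding Phi_ab_def
  by (intro star_projection_finprod finite_V cyclic_unitary.star_projection_spec_proj
      cyclic_unitary_gen ab.is_cring cz_ab_star_algebra)

lemma Phi_ab_closed [simp]: "Phi_ab k V \<psi> \<in> carrier ab"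
  using star_projection_Phi_ab by (rule star_projection.proj_closed)

lemma finite_C: "finite C"
  using C finite_V by (rule finite_subset[OF _ finite_PiE]) auto

lemma finsum_Phi_ab: "(\<Oplus>\<^bsub>ab\<^esub>\<psi>\<in>V \<rightarrow>\<^sub>E {..<k}. Phi_ab k V \<psi>) = \<one>\<^bsub>ab\<^esub>"
  unfolding Phi_ab_def
  by (rule ab.finsum_PiE_finprod_eq_one)
     (auto simp: finite_V q_closed cyclic_unitary.finsum_spec_proj[OF cyclic_unitary_gen])

text \<open>By commutativity the factor of \<open>Phi_ab\<close> at \<open>x\<close> can be moved to
  the front, where orthogonality of the spectral projections of one generator decides.\<close>

lemma q_mult_Phi_ab:
  assumes "x \<in> V" "a < k" "\<psi> \<in> V \<rightarrow>\<^sub>E {..<k}"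
  shows "q x a \<otimes>\<^bsub>ab\<^esub> Phi_ab k V \<psi> = (if \<psi> x = a then Phi_ab k V \<psi> else \<zero>\<^bsub>ab\<^esub>)"
proof -
  let ?P = "\<Otimes>\<^bsub>ab\<^esub>y\<in>V - {x}. q y (\<psi> y)"
  have P: "?P \<in> carrier ab"
    by (intro ab.finprod_closed) (auto simp: q_closed)
  have "Phi_ab k V \<psi> = (\<Otimes>\<^bsub>ab\<^esub>y\<in>insert x (V - {x}). q y (\<psi> y))"
    using assms(1) by (simp add: Phi_ab_def insert_absorb)
  also have "\<dots> = q x (\<psi> x) \<otimes>\<^bsub>ab\<^esub> ?P"
    using assms(1) finite_V by (subst ab.finprod_insert) (auto simp: q_closed)
  finally have Phi: "Phi_ab k V \<psi> = q x (\<psi> x) \<otimes>\<^bsub>ab\<^esub> ?P" .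
  have "\<psi> x < k"
    using assms by auto
  then have "q x a \<otimes>\<^bsub>ab\<^esub> q x (\<psi> x) = (if \<psi> x = a then q x (\<psi> x) else \<zero>\<^bsub>ab\<^esub>)"
    using cyclic_unitary.spec_proj_mult[OF cyclic_unitary_gen[OF assms(1)] _ assms(2)] by simp
  moreover have "q x a \<otimes>\<^bsub>ab\<^esub> Phi_ab k V \<psi> = (q x a \<otimes>\<^bsub>ab\<^esub> q x (\<psi> x)) \<otimes>\<^bsub>ab\<^esub> ?P"
    unfolding Phi using P q_closed[OF assms(1)] by (simp add: ab.m_assoc)
  ultimately show ?thesis
    using P by (simp add: Phi)
qed

lemma ideal_J: "ideal J ab"
  unfolding constraint_ideal_def by (intro ab.genideal_ideal) auto

lemma star_J: "x \<in> J \<Longrightarrow> star ab x \<in> J"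
  unfolding constraint_ideal_def
  by (rule ab.genideal_star_closed) (auto simp: star_projection.proj_star[OF star_projection_Phi_ab])

lemmas constraint_alg_quot =
  star_quot_star_algebra[OF cz_ab_star_algebra ideal_J star_J, folded constraint_alg_def]

sublocale E: star_algebra E
  by (rule constraint_alg_quot)

sublocale quot: star_alg_hom ab E "(+>\<^bsub>ab\<^esub>) J"
  by unfold_locales (rule constraint_alg_quot)

definition gen :: "'x \<Rightarrow> 'x star_term set set" where
  "gen x = J +>\<^bsub>ab\<^esub> cz_ab_gen k V x"

lemma cyclic_unitary_gen_quot: "x \<in> V \<Longrightarrow> cyclic_unitary E k (gen x)"
  unfolding gen_def
  by (intro cyclic_unitary.cyclic_unitary_image[OF cyclic_unitary_gen] E.star_algebra_axioms
      quot.star_hom)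

lemma star_projection_Phi: "star_projection E (Phi k V C \<psi>)"
  unfolding Phi_def
  by (intro star_projection.star_projection_image[OF star_projection_Phi_ab] E.star_algebra_axioms
      quot.star_hom)

lemma Phi_closed [simp]: "Phi k V C \<psi> \<in> carrier E"
  using star_projection_Phi by (rule star_projection.proj_closed)

lemma Phi_eq_zero:
  assumes "\<psi> \<in> V \<rightarrow>\<^sub>E {..<k}" "\<psi> \<notin> C"
  shows "Phi k V C \<psi> = \<zero>\<^bsub>E\<^esub>"
proof -
  interpret J: ideal J ab by (rule ideal_J)
  have "Phi_ab k V ` ((V \<rightarrow>\<^sub>E {..<k}) - C) \<subseteq> J"
    unfolding constraint_ideal_def by (intro ab.genideal_self) auto
  then have mem: "Phi_ab k V \<psi> \<in> J"
    using assms by auto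
  have "J +>\<^bsub>ab\<^esub> y = J" if "y \<in> J" for y
    using that by (rule ab.a_coset_join2[OF J.a_Hcarr[OF that] J.a_subgroup])
  then show ?thesis
    using mem J.zero_closed quot.hom_zero unfolding Phi_def by metis
qed

text \<open>Forbidden assignments vanish in the quotient. A general \<open>D\<close> allows the use
  both for all assignments and for those with a prescribed value at \<open>x\<close>.\<close>

lemma finsum_Phi_restrict:
  assumes "D \<subseteq> V \<rightarrow>\<^sub>E {..<k}"
  shows "(\<Oplus>\<^bsub>E\<^esub>\<psi>\<in>D. Phi k V C \<psi>) = (\<Oplus>\<^bsub>E\<^esub>\<psi>\<in>D \<inter> C. Phi k V C \<psi>)"
proof (rule E.add.finprod_mono_neutral_cong_right)
  show "finite D"
    using assms finite_V by (rule finite_subset[OF _ finite_PiE]) auto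
  show "Phi k V C \<psi> = \<zero>\<^bsub>E\<^esub>" if "\<psi> \<in> D - D \<inter> C" for \<psi>
    using that assms by (intro Phi_eq_zero) auto
qed simp_all

lemma finsum_Phi: "(\<Oplus>\<^bsub>E\<^esub>\<psi>\<in>C. Phi k V C \<psi>) = \<one>\<^bsub>E\<^esub>"
proof -
  have "\<one>\<^bsub>E\<^esub> = J +>\<^bsub>ab\<^esub> (\<Oplus>\<^bsub>ab\<^esub>\<psi>\<in>V \<rightarrow>\<^sub>E {..<k}. Phi_ab k V \<psi>)"
    by (simp add: finsum_Phi_ab)
  also have "\<dots> = (\<Oplus>\<^bsub>E\<^esub>\<psi>\<in>V \<rightarrow>\<^sub>E {..<k}. Phi k V C \<psi>)"
    unfolding Phi_def by (intro quot.hom_finsum) auto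
  also have "\<dots> = (\<Oplus>\<^bsub>E\<^esub>\<psi>\<in>C. Phi k V C \<psi>)"
    using C finsum_Phi_restrict[OF order.refl] by (simp add: Int_absorb1)
  finally show ?thesis ..
qed

text \<open>In the abelian algebra, multiply the spectral projection by one, written as the sum of
  all \<open>Phi_ab\<close>: only assignments with the right value at \<open>x\<close> survive. The
  quotient map then drops the forbidden ones.\<close>

lemma spec_proj_gen:
  assumes x: "x \<in> V" and a: "a < k"
  shows "spec_proj E k a (gen x) = (\<Oplus>\<^bsub>E\<^esub>\<psi>\<in>{\<psi>\<in>C. \<psi> x = a}. Phi k V C \<psi>)"
proof -
  have finite: "finite (V \<rightarrow>\<^sub>E {..<k})"
    using finite_V by (simp add: finite_PiE)
  have gen: "cz_ab_gen k V x \<in> carrier ab"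
    using cyclic_unitary_gen[OF x] by (rule cyclic_unitary.u_closed)
  have "q x a = q x a \<otimes>\<^bsub>ab\<^esub> (\<Oplus>\<^bsub>ab\<^esub>\<psi>\<in>V \<rightarrow>\<^sub>E {..<k}. Phi_ab k V \<psi>)"
    using q_closed[OF x] by (simp add: finsum_Phi_ab)
  also have "\<dots> = (\<Oplus>\<^bsub>ab\<^esub>\<psi>\<in>V \<rightarrow>\<^sub>E {..<k}. q x a \<otimes>\<^bsub>ab\<^esub> Phi_ab k V \<psi>)"
    using finite q_closed[OF x] by (intro ab.finsum_rdistr) auto
  also have "\<dots> = (\<Oplus>\<^bsub>ab\<^esub>\<psi>\<in>{\<psi>\<in>V \<rightarrow>\<^sub>E {..<k}. \<psi> x = a}. Phi_ab k V \<psi>)"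
    using finite q_mult_Phi_ab[OF x a] q_closed[OF x]
    by (intro ab.add.finprod_mono_neutral_cong_right) auto
  finally have eq: "q x a = (\<Oplus>\<^bsub>ab\<^esub>\<psi>\<in>{\<psi>\<in>V \<rightarrow>\<^sub>E {..<k}. \<psi> x = a}. Phi_ab k V \<psi>)" .
  have "spec_proj E k a (gen x) = J +>\<^bsub>ab\<^esub> q x a"
    using quot.hom_spec_proj[OF gen] by (simp add: gen_def)
  also have "\<dots> = (\<Oplus>\<^bsub>E\<^esub>\<psi>\<in>{\<psi>\<in>V \<rightarrow>\<^sub>E {..<k}. \<psi> x = a}. Phi k V C \<psi>)"
    unfolding Phi_def eq by (intro quot.hom_finsum) auto
  also have "\<dots> = (\<Oplus>\<^bsub>E\<^esub>\<psi>\<in>{\<psi>\<in>C. \<psi> x = a}. Phi k V C \<psi>)"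
    using C by (subst finsum_Phi_restrict) (auto intro!: arg_cong[where f = "finsum E _"])
  finally show ?thesis .
qed

lemma one_minus_spec_proj_gen:
  assumes x: "x \<in> V" and a: "a < k"
  shows "\<one>\<^bsub>E\<^esub> \<ominus>\<^bsub>E\<^esub> spec_proj E k a (gen x) = (\<Oplus>\<^bsub>E\<^esub>\<psi>\<in>{\<psi>\<in>C. \<psi> x \<noteq> a}. Phi k V C \<psi>)"
proof -
  let ?S = "\<Oplus>\<^bsub>E\<^esub>\<psi>\<in>{\<psi>\<in>C. \<psi> x = a}. Phi k V C \<psi>"
  let ?T = "\<Oplus>\<^bsub>E\<^esub>\<psi>\<in>{\<psi>\<in>C. \<psi> x \<noteq> a}. Phi k V C \<psi>"
  have closed: "?S \<in> carrier E" "?T \<in> carrier E"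
    by (auto intro!: E.finsum_closed)
  have "{\<psi>\<in>C. \<psi> x \<noteq> a} \<union> {\<psi>\<in>C. \<psi> x = a} = C"
    by auto
  then have "\<one>\<^bsub>E\<^esub> = (\<Oplus>\<^bsub>E\<^esub>\<psi>\<in>{\<psi>\<in>C. \<psi> x \<noteq> a} \<union> {\<psi>\<in>C. \<psi> x = a}. Phi k V C \<psi>)"
    by (simp add: finsum_Phi)
  also have "\<dots> = ?T \<oplus>\<^bsub>E\<^esub> ?S"
    using finite_C by (intro E.finsum_Un_disjoint) auto
  finally show ?thesis
    using closed by (simp add: spec_proj_gen[OF x a] E.minus_eq E.a_assoc E.r_neg)
qed

end

section \<open>The tracial order\<close>

text \<open>The elements that count as nonnegative. With this set the properties of the order become
  closure properties of a convex cone.\<close>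

definition tracial_cone :: "('a, 'm) star_alg_scheme \<Rightarrow> 'a set" where
  "tracial_cone A =
     {(\<Oplus>\<^bsub>A\<^esub>j\<in>{..<p}. star A (c j) \<otimes>\<^bsub>A\<^esub> c j) \<oplus>\<^bsub>A\<^esub>
      (\<Oplus>\<^bsub>A\<^esub>l\<in>{..<q}. f l \<otimes>\<^bsub>A\<^esub> g l \<ominus>\<^bsub>A\<^esub> g l \<otimes>\<^bsub>A\<^esub> f l) | (p::nat) (q::nat) c f g.
      c \<in> {..<p} \<rightarrow> carrier A \<and> f \<in> {..<q} \<rightarrow> carrier A \<and> g \<in> {..<q} \<rightarrow> carrier A}"

lemma sos_tracial_le_iff: "sos_tracial_le A a b \<longleftrightarrow> b \<ominus>\<^bsub>A\<^esub> a \<in> tracial_cone A"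
  unfolding sos_tracial_le_def tracial_cone_def by blast

text \<open>Concatenation of two finite sequences; it is what closes the cone under addition, as its
  members are sums over initial segments.\<close>

lemma (in abelian_monoid) finsum_lessThan_append:
  assumes "f \<in> {..<m} \<rightarrow> carrier G" "g \<in> {..<n} \<rightarrow> carrier G"
  shows "(\<Oplus>i\<in>{..<m + n}. if i < m then f i else g (i - m)) =
    (\<Oplus>i\<in>{..<m}. f i) \<oplus> (\<Oplus>i\<in>{..<n::nat}. g i)"
proof -
  let ?h = "\<lambda>i. if i < m then f i else g (i - m)"

  have "(+) m ` {..<n} = {m..<m + n}"
    by (simp add: lessThan_atLeast0 add.commute)
  then have split: "{..<m + n} = {..<m} \<union> (+) m ` {..<n}"
    by auto
  have "(\<Oplus>i\<in>{..<m + n}. ?h i) = (\<Oplus>i\<in>{..<m}. ?h i) \<oplus> (\<Oplus>i\<in>(+) m ` {..<n}. ?h i)"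
    unfolding split using assms by (intro finsum_Un_disjoint) auto
  also have "(\<Oplus>i\<in>{..<m}. ?h i) = (\<Oplus>i\<in>{..<m}. f i)"
    using assms by (intro finsum_cong') auto
  also have "(\<Oplus>i\<in>(+) m ` {..<n}. ?h i) = (\<Oplus>i\<in>{..<n}. ?h (m + i))"
    using assms by (intro finsum_reindex) auto
  also have "\<dots> = (\<Oplus>i\<in>{..<n}. g i)"
    using assms by (intro finsum_cong') auto
  finally show ?thesis .
qed

context star_algebra begin

lemma tracial_coneI:
  assumes "c \<in> {..<p::nat} \<rightarrow> carrier A" "f \<in> {..<q::nat} \<rightarrow> carrier A" "g \<in> {..<q} \<rightarrow> carrier A"
    "d = (\<Oplus>j\<in>{..<p}. star A (c j) \<otimes> c j) \<oplus> (\<Oplus>l\<in>{..<q}. f l \<otimes> g l \<ominus> g l \<otimes> f l)"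
  shows "d \<in> tracial_cone A"
  unfolding tracial_cone_def using assms by blast

lemma tracial_coneE:
  assumes "d \<in> tracial_cone A"
  obtains p q :: nat and c f g where "c \<in> {..<p} \<rightarrow> carrier A" "f \<in> {..<q} \<rightarrow> carrier A"
    "g \<in> {..<q} \<rightarrow> carrier A"
    "d = (\<Oplus>j\<in>{..<p}. star A (c j) \<otimes> c j) \<oplus> (\<Oplus>l\<in>{..<q}. f l \<otimes> g l \<ominus> g l \<otimes> f l)"
  using assms unfolding tracial_cone_def by blast

lemma tracial_cone_zero: "\<zero> \<in> tracial_cone A"
  by (rule tracial_coneI[where p = 0 and q = 0]) auto

lemma tracial_cone_square: "x \<in> carrier A \<Longrightarrow> star A x \<otimes> x \<in> tracial_cone A"
  by (rule tracial_coneI[where p = 1 and q = 0 and c = "\<lambda>_. x"])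
     (auto simp: star_closed lessThan_Suc)

text \<open>Exchanging \<open>x\<close> and \<open>y\<close> puts the negative into the cone as
  well, so commutators are zero for the order.\<close>

lemma tracial_cone_commutator:
  "x \<in> carrier A \<Longrightarrow> y \<in> carrier A \<Longrightarrow> x \<otimes> y \<ominus> y \<otimes> x \<in> tracial_cone A"
  by (rule tracial_coneI[where p = 0 and q = 1 and f = "\<lambda>_. x" and g = "\<lambda>_. y"])
     (auto simp: lessThan_Suc)

lemma tracial_cone_add:
  assumes "d \<in> tracial_cone A" "d' \<in> tracial_cone A"
  shows "d \<oplus> d' \<in> tracial_cone A"
proof -
  obtain p q c f g where d: "c \<in> {..<p::nat} \<rightarrow> carrier A" "f \<in> {..<q::nat} \<rightarrow> carrier A"
      "g \<in> {..<q} \<rightarrow> carrier A"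
      "d = (\<Oplus>j\<in>{..<p}. star A (c j) \<otimes> c j) \<oplus> (\<Oplus>l\<in>{..<q}. f l \<otimes> g l \<ominus> g l \<otimes> f l)"
    using assms(1) by (rule tracial_coneE)
  obtain p' q' c' f' g' where d': "c' \<in> {..<p'::nat} \<rightarrow> carrier A" "f' \<in> {..<q'::nat} \<rightarrow> carrier A"
      "g' \<in> {..<q'} \<rightarrow> carrier A"
      "d' = (\<Oplus>j\<in>{..<p'}. star A (c' j) \<otimes> c' j) \<oplus> (\<Oplus>l\<in>{..<q'}. f' l \<otimes> g' l \<ominus> g' l \<otimes> f' l)"
    using assms(2) by (rule tracial_coneE)
  define C where "C i = (if i < p then c i else c' (i - p))" for i
  define F where "F i = (if i < q then f i else f' (i - q))" for i
  define G where "G i = (if i < q then g i else g' (i - q))" for i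
  let ?s = "\<lambda>c j. star A (c j) \<otimes> c j" and ?k = "\<lambda>f g l. f l \<otimes> g l \<ominus> g l \<otimes> f l"
  have closed: "?s c \<in> {..<p} \<rightarrow> carrier A" "?s c' \<in> {..<p'} \<rightarrow> carrier A"
    "?k f g \<in> {..<q} \<rightarrow> carrier A" "?k f' g' \<in> {..<q'} \<rightarrow> carrier A"
    using d(1-3) d'(1-3) by (auto simp: Pi_def star_closed)
  have s: "?s C = (\<lambda>i. if i < p then ?s c i else ?s c' (i - p))"
    and k: "?k F G = (\<lambda>i. if i < q then ?k f g i else ?k f' g' (i - q))"
    by (auto simp: C_def F_def G_def)
  have sums: "(\<Oplus>j\<in>{..<p + p'}. ?s C j) = (\<Oplus>j\<in>{..<p}. ?s c j) \<oplus> (\<Oplus>j\<in>{..<p'}. ?s c' j)"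
    "(\<Oplus>l\<in>{..<q + q'}. ?k F G l) = (\<Oplus>l\<in>{..<q}. ?k f g l) \<oplus> (\<Oplus>l\<in>{..<q'}. ?k f' g' l)"
    unfolding s k
    using finsum_lessThan_append[OF closed(1,2)] finsum_lessThan_append[OF closed(3,4)] .
  show ?thesis
  proof (rule tracial_coneI)
    show "C \<in> {..<p + p'} \<rightarrow> carrier A" "F \<in> {..<q + q'} \<rightarrow> carrier A"
      "G \<in> {..<q + q'} \<rightarrow> carrier A"
      using d(1-3) d'(1-3) by (simp_all add: C_def F_def G_def Pi_def)
    show "d \<oplus> d' = (\<Oplus>j\<in>{..<p + p'}. ?s C j) \<oplus> (\<Oplus>l\<in>{..<q + q'}. ?k F G l)"
      unfolding d(4) d'(4) sums using closed[THEN finsum_closed] by (simp only: a_ac a_closed)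
  qed
qed

text \<open>The scalar enters a square through its real square root, and a commutator through the
  first factor alone.\<close>

lemma tracial_cone_smult:
  assumes "0 \<le> r" "d \<in> tracial_cone A"
  shows "complex_of_real r \<odot> d \<in> tracial_cone A"
proof -
  obtain p q c f g where d: "c \<in> {..<p::nat} \<rightarrow> carrier A" "f \<in> {..<q::nat} \<rightarrow> carrier A"
      "g \<in> {..<q} \<rightarrow> carrier A"
      "d = (\<Oplus>j\<in>{..<p}. star A (c j) \<otimes> c j) \<oplus> (\<Oplus>l\<in>{..<q}. f l \<otimes> g l \<ominus> g l \<otimes> f l)"
    using assms(2) by (rule tracial_coneE)
  define C where "C i = complex_of_real (sqrt r) \<odot> c i" for i
  define F where "F i = complex_of_real r \<odot> f i" for i
  have "complex_of_real (sqrt r) * complex_of_real (sqrt r) = complex_of_real r"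
    using assms(1) by (simp flip: of_real_mult)
  then have sq: "star A (C j) \<otimes> C j = complex_of_real r \<odot> (star A (c j) \<otimes> c j)" if "j < p" for j
    using that d(1)
    by (auto simp: C_def star_smult smult_mult_left smult_mult_right star_closed smult_closed
        smult_assoc[symmetric] Pi_def)
  have comm: "F l \<otimes> g l \<ominus> g l \<otimes> F l = complex_of_real r \<odot> (f l \<otimes> g l \<ominus> g l \<otimes> f l)" if "l < q" for l
    using that d(2,3) by (auto simp: F_def smult_mult_left smult_mult_right smult_diff Pi_def)
  have closed: "(\<lambda>j. star A (c j) \<otimes> c j) \<in> {..<p} \<rightarrow> carrier A"
    "(\<lambda>l. f l \<otimes> g l \<ominus> g l \<otimes> f l) \<in> {..<q} \<rightarrow> carrier A"
    using d(1-3) by (auto simp: Pi_def star_closed)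
  have "(\<Oplus>j\<in>{..<p}. star A (C j) \<otimes> C j) = complex_of_real r \<odot> (\<Oplus>j\<in>{..<p}. star A (c j) \<otimes> c j)"
    "(\<Oplus>l\<in>{..<q}. F l \<otimes> g l \<ominus> g l \<otimes> F l) =
      complex_of_real r \<odot> (\<Oplus>l\<in>{..<q}. f l \<otimes> g l \<ominus> g l \<otimes> f l)"
    using closed by (auto simp: smult_finsum sq comm Pi_def smult_closed intro!: finsum_cong')
  then have "complex_of_real r \<odot> d =
      (\<Oplus>j\<in>{..<p}. star A (C j) \<otimes> C j) \<oplus> (\<Oplus>l\<in>{..<q}. F l \<otimes> g l \<ominus> g l \<otimes> F l)"
    using closed by (simp add: d(4) smult_r_distr finsum_closed)
  moreover have "C \<in> {..<p} \<rightarrow> carrier A" "F \<in> {..<q} \<rightarrow> carrier A"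
    using d(1,2) by (auto simp: C_def F_def intro!: smult_closed)
  ultimately show ?thesis
    using d(3) by (intro tracial_coneI)
qed

abbreviation tracial_le (infix \<open>\<lesssim>\<^sub>\<tau>\<close> 50) where "a \<lesssim>\<^sub>\<tau> b \<equiv> sos_tracial_le A a b"

lemma tracial_le_refl: "a \<in> carrier A \<Longrightarrow> a \<lesssim>\<^sub>\<tau> a"
  by (simp add: sos_tracial_le_iff minus_eq r_neg tracial_cone_zero)

lemma tracial_le_trans:
  assumes "a \<in> carrier A" "b \<in> carrier A" "c \<in> carrier A" "a \<lesssim>\<^sub>\<tau> b" "b \<lesssim>\<^sub>\<tau> c"
  shows "a \<lesssim>\<^sub>\<tau> c"
proof -
  have "c \<ominus> a = (c \<ominus> b) \<oplus> (b \<ominus> a)"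
    using assms(1-3) by (simp add: minus_eq a_assoc r_neg1)
  then show ?thesis
    using assms(4,5) by (simp add: sos_tracial_le_iff tracial_cone_add)
qed

lemma tracial_le_add:
  assumes "a \<in> carrier A" "b \<in> carrier A" "c \<in> carrier A" "d \<in> carrier A" "a \<lesssim>\<^sub>\<tau> b" "c \<lesssim>\<^sub>\<tau> d"
  shows "a \<oplus> c \<lesssim>\<^sub>\<tau> b \<oplus> d"
proof -
  have "(b \<oplus> d) \<ominus> (a \<oplus> c) = (b \<ominus> a) \<oplus> (d \<ominus> c)"
    using assms(1-4) by (simp add: minus_eq minus_add a_ac)
  then show ?thesis
    using assms(5,6) by (simp add: sos_tracial_le_iff tracial_cone_add)
qed

lemma tracial_le_smult:
  assumes "0 \<le> r" "a \<in> carrier A" "b \<in> carrier A" "a \<lesssim>\<^sub>\<tau> b"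
  shows "complex_of_real r \<odot> a \<lesssim>\<^sub>\<tau> complex_of_real r \<odot> b"
  using assms by (simp add: sos_tracial_le_iff tracial_cone_smult flip: smult_diff)

lemma tracial_le_finsum:
  assumes "finite I" "\<And>i. i \<in> I \<Longrightarrow> f i \<in> carrier A" "\<And>i. i \<in> I \<Longrightarrow> g i \<in> carrier A"
    "\<And>i. i \<in> I \<Longrightarrow> f i \<lesssim>\<^sub>\<tau> g i"
  shows "finsum A f I \<lesssim>\<^sub>\<tau> finsum A g I"
  using assms
proof (induction I rule: finite_induct)
  case (insert i I)
  then have "f \<in> I \<rightarrow> carrier A" "g \<in> I \<rightarrow> carrier A"
    by auto
  with insert show ?case
    by (simp add: tracial_le_add finsum_closed)
qed (simp add: tracial_le_refl)

lemma tracial_le_commute: "x \<in> carrier A \<Longrightarrow> y \<in> carrier A \<Longrightarrow> x \<otimes> y \<lesssim>\<^sub>\<tau> y \<otimes> x"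
  by (simp add: sos_tracial_le_iff tracial_cone_commutator)

lemma tracial_le_square_mono:
  assumes "x \<in> carrier A" "r \<le> s"
  shows "complex_of_real r \<odot> (star A x \<otimes> x) \<lesssim>\<^sub>\<tau> complex_of_real s \<odot> (star A x \<otimes> x)"
proof -
  let ?y = "star A x \<otimes> x"
  have y: "?y \<in> carrier A"
    using assms(1) by (simp add: star_closed)
  have "complex_of_real s \<odot> ?y = complex_of_real (s - r) \<odot> ?y \<oplus> complex_of_real r \<odot> ?y"
    using y by (simp flip: smult_l_distr)
  then have "complex_of_real s \<odot> ?y \<ominus> complex_of_real r \<odot> ?y = complex_of_real (s - r) \<odot> ?y"
    using y by (simp add: minus_eq a_assoc r_neg smult_closed)
  moreover have "complex_of_real (s - r) \<odot> ?y \<in> tracial_cone A"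
    using assms by (intro tracial_cone_smult tracial_cone_square) simp_all
  ultimately show ?thesis
    by (simp only: sos_tracial_le_iff)
qed

text \<open>The square is q(pq), and moving the outer q to the other end gives (pq)q = pq. The first
  half makes a square linear in \<open>q\<close>, the second turns each term of the expansion back
  into a square.\<close>

lemma projections_square_tracial_eq:
  assumes "star_projection A p" "star_projection A q"
  shows "star A (p \<otimes> q) \<otimes> (p \<otimes> q) \<lesssim>\<^sub>\<tau> p \<otimes> q" "p \<otimes> q \<lesssim>\<^sub>\<tau> star A (p \<otimes> q) \<otimes> (p \<otimes> q)"
proof -
  interpret p: star_projection A p by fact
  interpret q: star_projection A q by fact
  have "star A (p \<otimes> q) \<otimes> (p \<otimes> q) = q \<otimes> (p \<otimes> p) \<otimes> q"
    by (simp add: star_mult p.proj_star q.proj_star m_assoc)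
  then have sq: "star A (p \<otimes> q) \<otimes> (p \<otimes> q) = q \<otimes> (p \<otimes> q)"
    by (simp add: p.proj_idem m_assoc)
  have pq: "(p \<otimes> q) \<otimes> q = p \<otimes> q"
    by (simp add: m_assoc q.proj_idem)
  show "star A (p \<otimes> q) \<otimes> (p \<otimes> q) \<lesssim>\<^sub>\<tau> p \<otimes> q" "p \<otimes> q \<lesssim>\<^sub>\<tau> star A (p \<otimes> q) \<otimes> (p \<otimes> q)"
    using tracial_le_commute[of q "p \<otimes> q"] tracial_le_commute[of "p \<otimes> q" q] by (simp_all add: sq pq)
qed

section \<open>Weights\<close>

text \<open>Merges the indices that \<open>e\<close> identifies. It serves twice: for coinciding
  listed elements, and for the passage from triples with a variable to pairs of clauses.\<close>

lemma finsum_weights_fibres: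
  assumes "finite M" "finite L" "e \<in> M \<rightarrow> L" "x \<in> L \<rightarrow> carrier A"
  shows "(\<Oplus>m\<in>M. complex_of_real (w m) \<odot> x (e m)) =
    (\<Oplus>t\<in>L. complex_of_real (\<Sum>m | m \<in> M \<and> e m = t. w m) \<odot> x t)"
proof -
  have "(\<Oplus>m\<in>M. complex_of_real (w m) \<odot> x (e m)) =
      (\<Oplus>t\<in>L. \<Oplus>m\<in>{m\<in>M. e m = t}. complex_of_real (w m) \<odot> x (e m))"
    using assms by (intro finsum_fibres) (auto intro!: smult_closed)
  also have "\<dots> = (\<Oplus>t\<in>L. complex_of_real (\<Sum>m | m \<in> M \<and> e m = t. w m) \<odot> x t)"
  proof (rule finsum_cong')
    fix t assume t: "t \<in> L"
    have "(\<Oplus>m\<in>{m\<in>M. e m = t}. complex_of_real (w m) \<odot> x (e m)) =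
        (\<Oplus>m\<in>{m\<in>M. e m = t}. complex_of_real (w m) \<odot> x t)"
      using t assms(4) by (intro finsum_cong') (auto intro!: smult_closed)
    also have "\<dots> = (\<Sum>m | m \<in> M \<and> e m = t. complex_of_real (w m)) \<odot> x t"
      using t assms by (intro finsum_smult_left) auto
    finally show "(\<Oplus>m\<in>{m\<in>M. e m = t}. complex_of_real (w m) \<odot> x (e m)) =
        complex_of_real (\<Sum>m | m \<in> M \<and> e m = t. w m) \<odot> x t"
      by simp
  qed (use assms in \<open>auto intro!: smult_closed\<close>)
  finally show ?thesis .
qed

context
  fixes L :: "'t set" and w :: "'t \<Rightarrow> real" and e :: "'t \<Rightarrow> 'a"
  assumes L: "finite L" and w: "\<And>t. t \<in> L \<Longrightarrow> 0 \<le> w t" and e: "e \<in> L \<rightarrow> carrier A"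
begin

lemma listed_weight_support: "{a \<in> carrier A. listed_weight L w e a \<noteq> 0} \<subseteq> e ` L"
proof
  fix a assume "a \<in> {a \<in> carrier A. listed_weight L w e a \<noteq> 0}"
  then have "(\<Sum>t | t \<in> L \<and> e t = a. w t) \<noteq> 0"
    by (simp add: listed_weight_def)
  then have "{t. t \<in> L \<and> e t = a} \<noteq> {}"
    by (metis sum.empty)
  then show "a \<in> e ` L"
    by auto
qed

lemma weighted_star_algebra_listed_weight: "weighted_star_algebra A (listed_weight L w e)"
proof
  show "0 \<le> listed_weight L w e a" for a
    using w by (auto simp: listed_weight_def intro: sum_nonneg)
  show "finite {a \<in> carrier A. listed_weight L w e a \<noteq> 0}"
    using listed_weight_support L by (rule finite_subset[OF _ finite_imageI])
qed

lemma weighted_squares_listed_weight: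
  "weighted_squares A (listed_weight L w e) =
    (\<Oplus>t\<in>L. complex_of_real (w t) \<odot> (star A (e t) \<otimes> e t))"
proof -
  have "weighted_squares A (listed_weight L w e) =
      (\<Oplus>a\<in>e ` L. complex_of_real (listed_weight L w e a) \<odot> (star A a \<otimes> a))"
    unfolding weighted_squares_def using e L listed_weight_support
    by (intro add.finprod_mono_neutral_cong_left)
       (auto simp: smult_zero_left star_closed Pi_def intro!: smult_closed)
  also have "\<dots> = (\<Oplus>t\<in>L. complex_of_real (w t) \<odot> (star A (e t) \<otimes> e t))"
    unfolding listed_weight_def using e L
    by (intro finsum_weights_fibres[symmetric]) (auto simp: Pi_def star_closed)
  finally show ?thesis .
qed

end

text \<open>Once equal squares are collected, only total weights have to be compared, since a square
  with nonnegative weight is nonnegative. For indices that \<open>e\<close> misses the sum is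
  empty.\<close>

lemma tracial_le_regroup:
  assumes "finite M" "finite L" "e \<in> M \<rightarrow> L" "x \<in> L \<rightarrow> carrier A"
    and le: "\<And>t. t \<in> L \<Longrightarrow> (\<Sum>m | m \<in> M \<and> e m = t. w m) \<le> v t"
  shows "(\<Oplus>m\<in>M. complex_of_real (w m) \<odot> (star A (x (e m)) \<otimes> x (e m))) \<lesssim>\<^sub>\<tau>
    (\<Oplus>t\<in>L. complex_of_real (v t) \<odot> (star A (x t) \<otimes> x t))"
proof -
  have x: "x t \<in> carrier A" if "t \<in> L" for t
    using assms(4) that by auto
  have "(\<Oplus>m\<in>M. complex_of_real (w m) \<odot> (star A (x (e m)) \<otimes> x (e m))) =
      (\<Oplus>t\<in>L. complex_of_real (\<Sum>m | m \<in> M \<and> e m = t. w m) \<odot> (star A (x t) \<otimes> x t))"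
    using assms(1-3) x by (intro finsum_weights_fibres) (auto simp: star_closed)
  also have "\<dots> \<lesssim>\<^sub>\<tau> (\<Oplus>t\<in>L. complex_of_real (v t) \<odot> (star A (x t) \<otimes> x t))"
    using assms(2) x le
    by (intro tracial_le_finsum tracial_le_square_mono) (auto simp: star_closed intro!: smult_closed)
  finally show ?thesis .
qed

end

section \<open>The homomorphism\<close>

locale constraint_system_data =
  fixes k :: nat and S :: "'x csystem" and \<pi> :: "(nat \<times> nat) pmf" and \<pi>' :: "nat pmf"
  assumes csystem: "constraint_system k S"
begin

text \<open>Keeps the index set in the form \<open>{1..num S}\<close>.\<close>

declare One_nat_def [simp del]

abbreviation "I \<equiv> {1..num S}"
abbreviation "V \<equiv> scope S"
abbreviation "D \<equiv> cc_alg k S"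

lemma k_pos: "0 < k" and finite_variables: "finite (variables S)"
  and scope_subset: "i \<in> I \<Longrightarrow> V i \<subseteq> variables S"
  and allowed_subset: "i \<in> I \<Longrightarrow> allowed S i \<subseteq> V i \<rightarrow>\<^sub>E {..<k}"
  using csystem by (auto simp: constraint_system_def)

lemma finite_scope: "i \<in> I \<Longrightarrow> finite (V i)"
  using scope_subset finite_variables by (rule finite_subset)

lemma scope_data: "i \<in> I \<Longrightarrow> constraint_data k (V i) (allowed S i)"
  by (intro constraint_data.intro k_pos finite_scope allowed_subset)

lemma finite_allowed: "i \<in> I \<Longrightarrow> finite (allowed S i)"
  using scope_data by (rule constraint_data.finite_C)

lemma clause_star_algebra: "i \<in> I \<Longrightarrow> star_algebra (clause_alg k S i)"
  unfolding clause_alg_def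
  using constraint_data.constraint_alg_quot(1)[OF scope_data] .

sublocale D: star_algebra D
  unfolding cc_alg_def free_product_def by (rule presented_star_algebra)

abbreviation "incl \<equiv> fp_incl I (clause_alg k S)"

lemma incl_star_hom: "i \<in> I \<Longrightarrow> incl i \<in> star_hom (clause_alg k S i) D"
  unfolding cc_alg_def using clause_star_algebra by (intro fp_incl_star_hom)

lemma incl_hom: "i \<in> I \<Longrightarrow> star_alg_hom (clause_alg k S i) D (incl i)"
  by (intro star_alg_hom.intro star_alg_hom_axioms.intro clause_star_algebra incl_star_hom
      D.star_algebra_axioms)

lemma star_projection_cc_Phi:
  assumes i: "i \<in> I"
  shows "star_projection D (cc_Phi k S i \<psi>)"
  unfolding cc_Phi_def
  using incl_star_hom[OF i] unfolding clause_alg_def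
  by (intro star_projection.star_projection_image[OF constraint_data.star_projection_Phi]
      scope_data i D.star_algebra_axioms)

lemma cc_Phi_closed: "i \<in> I \<Longrightarrow> cc_Phi k S i \<psi> \<in> carrier D"
  using star_projection_cc_Phi by (rule star_projection.proj_closed)

definition rep :: "'x \<Rightarrow> nat" where
  "rep x = (SOME i. i \<in> I \<and> x \<in> V i)"

text \<open>A variable in no scope still is a generator of the free factor and needs an image; the
  unit satisfies the cyclic relations.\<close>

definition unitary :: "'x \<Rightarrow> 'x cc_elem" where
  "unitary x = (if \<exists>i\<in>I. x \<in> V i
     then incl (rep x) (constraint_data.gen k (V (rep x)) (allowed S (rep x)) x) else \<one>\<^bsub>D\<^esub>)"

lemma rep: "i \<in> I \<Longrightarrow> x \<in> V i \<Longrightarrow> rep x \<in> I \<and> x \<in> V (rep x)"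
  unfolding rep_def by (rule someI[of _ i]) simp

lemma unitary_eq:
  "i \<in> I \<Longrightarrow> x \<in> V i \<Longrightarrow>
    unitary x = incl (rep x) (constraint_data.gen k (V (rep x)) (allowed S (rep x)) x)"
  by (auto simp: unitary_def)

lemma cyclic_unitary_unitary: "cyclic_unitary D k (unitary x)"
proof (cases "\<exists>i\<in>I. x \<in> V i")
  case True
  then obtain i where i: "i \<in> I" "x \<in> V i"
    by blast
  note r = conjunct1[OF rep[OF i]] conjunct2[OF rep[OF i]]
  show ?thesis
    unfolding unitary_eq[OF i]
    using cyclic_unitary.cyclic_unitary_image[OF constraint_data.cyclic_unitary_gen_quot[OF scope_data[OF r(1)] r(2)]]
      D.star_algebra_axioms incl_star_hom[OF r(1)] by (simp add: clause_alg_def)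
next
  case False
  then have "unitary x = \<one>\<^bsub>D\<^esub>"
    by (simp add: unitary_def)
  then show ?thesis
    using D.cyclic_unitary_one[OF k_pos] by simp
qed

text \<open>Computed in the clause algebra with index \<open>rep x\<close>, where the unitary is a
  generator, and carried over by the inclusion.\<close>

lemma one_minus_spec_proj_unitary:
  assumes i: "i \<in> I" "x \<in> V i" and a: "a < k"
  shows "\<one>\<^bsub>D\<^esub> \<ominus>\<^bsub>D\<^esub> spec_proj D k a (unitary x) =
    (\<Oplus>\<^bsub>D\<^esub>\<psi>\<in>{\<psi>\<in>allowed S (rep x). \<psi> x \<noteq> a}. cc_Phi k S (rep x) \<psi>)"
proof -
  note r = conjunct1[OF rep[OF i]] conjunct2[OF rep[OF i]]
  interpret r: constraint_data k "V (rep x)" "allowed S (rep x)"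
    using r(1) by (rule scope_data)
  interpret h: star_alg_hom r.E D "incl (rep x)"
    using incl_hom[OF r(1)] by (simp add: clause_alg_def)
  have gen: "r.gen x \<in> carrier r.E"
    using r.cyclic_unitary_gen_quot[OF r(2)] by (rule cyclic_unitary.u_closed)
  have proj: "spec_proj r.E k a (r.gen x) \<in> carrier r.E"
    using r.cyclic_unitary_gen_quot[OF r(2)] by (rule cyclic_unitary.spec_proj_closed)
  have "\<one>\<^bsub>D\<^esub> \<ominus>\<^bsub>D\<^esub> spec_proj D k a (unitary x) =
      incl (rep x) (\<one>\<^bsub>r.E\<^esub> \<ominus>\<^bsub>r.E\<^esub> spec_proj r.E k a (r.gen x))"
    using gen proj by (simp add: unitary_eq[OF i] h.hom_diff h.hom_spec_proj)
  also have "\<dots> = incl (rep x) (\<Oplus>\<^bsub>r.E\<^esub>\<psi>\<in>{\<psi>\<in>allowed S (rep x). \<psi> x \<noteq> a}.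
      Phi k (V (rep x)) (allowed S (rep x)) \<psi>)"
    by (simp only: r.one_minus_spec_proj_gen[OF r(2) a])
  also have "\<dots> = (\<Oplus>\<^bsub>D\<^esub>\<psi>\<in>{\<psi>\<in>allowed S (rep x). \<psi> x \<noteq> a}. cc_Phi k S (rep x) \<psi>)"
    unfolding cc_Phi_def by (rule h.hom_finsum) auto
  finally show ?thesis .
qed

section \<open>The two weighted families and the map between the algebras\<close>

abbreviation "cc_index \<equiv> {(i, j, \<phi>, \<psi>). i \<in> I \<and> j \<in> I \<and> \<phi> \<in> allowed S i \<and> \<psi> \<in> allowed S j \<and>
  restrict \<phi> (V i \<inter> V j) \<noteq> restrict \<psi> (V i \<inter> V j)}"
abbreviation "cv_index \<equiv> {(i, x, \<phi>). i \<in> I \<and> x \<in> V i \<and> \<phi> \<in> allowed S i}"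
abbreviation "cc_w \<equiv> \<lambda>(i, j, \<phi>, \<psi>). pmf \<pi> (i, j)"
abbreviation "cv_w \<equiv> \<lambda>(i, x, \<phi>). pmf \<pi>' i / real (card (V i))"
abbreviation "cc_elem \<equiv> \<lambda>(i, j, \<phi>, \<psi>). cc_Phi k S i \<phi> \<otimes>\<^bsub>D\<^esub> cc_Phi k S j \<psi>"
abbreviation "cv_elem \<equiv> \<lambda>(i, x, \<phi>). cv_Phi k S i \<phi> \<otimes>\<^bsub>cv_alg k S\<^esub>
  (\<one>\<^bsub>cv_alg k S\<^esub> \<ominus>\<^bsub>cv_alg k S\<^esub> spec_proj (cv_alg k S) k (\<phi> x) (cv_var k S x))"
abbreviation "img \<equiv> \<lambda>(i, x, \<phi>). cc_Phi k S i \<phi> \<otimes>\<^bsub>D\<^esub>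
  (\<one>\<^bsub>D\<^esub> \<ominus>\<^bsub>D\<^esub> spec_proj D k (\<phi> x) (unitary x))"

lemma finite_cc_index: "finite cc_index"
proof (rule finite_subset)
  show "cc_index \<subseteq> (SIGMA i:I. SIGMA j:I. allowed S i \<times> allowed S j)"
    by auto
qed (auto intro!: finite_SigmaI finite_allowed)

lemma finite_cv_index: "finite cv_index"
proof (rule finite_subset)
  show "cv_index \<subseteq> (SIGMA i:I. V i \<times> allowed S i)"
    by auto
qed (auto intro!: finite_SigmaI finite_allowed finite_scope)

lemma cc_elem_closed: "cc_elem \<in> cc_index \<rightarrow> carrier D"
  using cc_Phi_closed by auto

lemma cv_star_algebra: "star_algebra (cv_alg k S)"
  unfolding cv_alg_def free_product_with_def by (rule presented_star_algebra)

lemma Phi_clause_closed: "i \<in> I \<Longrightarrow> Phi k (V i) (allowed S i) \<psi> \<in> carrier (clause_alg k S i)"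
  unfolding clause_alg_def using constraint_data.Phi_closed[OF scope_data] .

lemma cv_Phi_closed:
  assumes i: "i \<in> I"
  shows "cv_Phi k S i \<phi> \<in> carrier (cv_alg k S)"
proof -
  have "fpw_incl I (clause_alg k S) (cz_free k (variables S)) i \<in>
      star_hom (clause_alg k S i) (cv_alg k S)"
    unfolding cv_alg_def by (intro fpw_incl_star_hom clause_star_algebra i)
  then show ?thesis
    unfolding cv_Phi_def star_hom_def using Phi_clause_closed[OF i] by (auto intro: ring_hom_closed)
qed

lemma cv_var_cyclic_unitary:
  assumes "x \<in> variables S"
  shows "cyclic_unitary (cv_alg k S) k (cv_var k S x)"
  unfolding cv_var_def cv_alg_def
  using cyclic_unitary.cyclic_unitary_image[OF cz_free_gen_cyclic_unitary[OF k_pos assms]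
      cv_star_algebra[unfolded cv_alg_def] fpw_incl_extra_star_hom[OF cz_free_star_algebra]] .

lemma cv_elem_closed: "cv_elem \<in> cv_index \<rightarrow> carrier (cv_alg k S)"
proof
  fix t assume t: "t \<in> cv_index"
  interpret C: star_algebra "cv_alg k S"
    by (rule cv_star_algebra)
  obtain i x \<phi> where "t = (i, x, \<phi>)" "i \<in> I" "x \<in> V i"
    using t by auto
  moreover from this have "spec_proj (cv_alg k S) k (\<phi> x) (cv_var k S x) \<in> carrier (cv_alg k S)"
    using scope_subset by (intro cyclic_unitary.spec_proj_closed cv_var_cyclic_unitary) auto
  ultimately show "cv_elem t \<in> carrier (cv_alg k S)"
    by (simp add: cv_Phi_closed)
qed

lemma star_projection_one_minus_spec_proj:
  "star_projection D (\<one>\<^bsub>D\<^esub> \<ominus>\<^bsub>D\<^esub> spec_proj D k a (unitary x))"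
  by (intro star_projection.star_projection_complement cyclic_unitary.star_projection_spec_proj
      cyclic_unitary_unitary)

lemma img_closed: "img \<in> cv_index \<rightarrow> carrier D"
  using cc_Phi_closed star_projection.proj_closed[OF star_projection_one_minus_spec_proj] by auto

text \<open>The free factor imposes only cyclic relations, one variable at a time, so the elements
  \<open>unitary x\<close> define a homomorphism on it; on the clause algebras the inclusions are
  taken.\<close>

lemma beta_exists:
  obtains \<beta> where "\<beta> \<in> star_hom (cv_alg k S) D" "\<And>t. t \<in> cv_index \<Longrightarrow> \<beta> (cv_elem t) = img t"
proof -
  obtain \<gamma> where \<gamma>: "\<gamma> \<in> star_hom (cz_free k (variables S)) D"
    "\<And>x. x \<in> variables S \<Longrightarrow> \<gamma> (cz_free_gen k (variables S) x) = unitary x"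
    using cz_free_universal[OF D.star_algebra_axioms, of "variables S" k unitary]
      cyclic_unitary_unitary by blast
  obtain \<beta> where \<beta>: "\<beta> \<in> star_hom (cv_alg k S) D"
    "\<And>i a. i \<in> I \<Longrightarrow> a \<in> carrier (clause_alg k S i) \<Longrightarrow>
      \<beta> (fpw_incl I (clause_alg k S) (cz_free k (variables S)) i a) = incl i a"
    "\<And>b. b \<in> carrier (cz_free k (variables S)) \<Longrightarrow>
      \<beta> (fpw_incl_extra I (clause_alg k S) (cz_free k (variables S)) b) = \<gamma> b"
    unfolding cv_alg_def
    by (rule free_product_with_universal[OF D.star_algebra_axioms, of I "clause_alg k S"
          "cz_free k (variables S)" incl \<gamma>])
       (use clause_star_algebra cz_free_star_algebra incl_star_hom \<gamma>(1) in auto)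
  interpret C: star_algebra "cv_alg k S"
    by (rule cv_star_algebra)
  interpret \<beta>: star_alg_hom "cv_alg k S" D \<beta>
    by unfold_locales (rule \<beta>(1))
  have Phi: "\<beta> (cv_Phi k S i \<phi>) = cc_Phi k S i \<phi>" if "i \<in> I" for i \<phi>
    unfolding cv_Phi_def cc_Phi_def by (intro \<beta>(2) Phi_clause_closed that)
  have var: "\<beta> (cv_var k S x) = unitary x" if "x \<in> variables S" for x
    unfolding cv_var_def using that cz_free_gen_cyclic_unitary[OF k_pos that]
    by (simp add: \<beta>(3) \<gamma>(2) cyclic_unitary.u_closed)
  have "\<beta> (cv_elem t) = img t" if t: "t \<in> cv_index" for t
  proof -
    obtain i x \<phi> where t: "t = (i, x, \<phi>)" "i \<in> I" "x \<in> V i"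
      using t by auto
    then have x: "x \<in> variables S"
      using scope_subset by blast
    note cv_var_cyclic_unitary[OF x]
    note closed = cyclic_unitary.u_closed[OF this] cyclic_unitary.spec_proj_closed[OF this, of "\<phi> x"]
      cv_Phi_closed[OF t(2), of \<phi>]
    then show ?thesis
      using t(1,2) by (simp add: \<beta>.hom_diff \<beta>.hom_spec_proj Phi var[OF x])
  qed
  with \<beta>(1) show thesis
    by (rule that)
qed

definition incons :: "nat \<times> 'x \<times> ('x \<Rightarrow> nat) \<Rightarrow> ('x \<Rightarrow> nat) set" where
  "incons t = (case t of (i, x, \<phi>) \<Rightarrow> {\<psi> \<in> allowed S (rep x). \<psi> x \<noteq> \<phi> x})"

text \<open>Forgets the variable and keeps only its clause. Several variables of \<open>V i\<close>
  may have the same \<open>rep\<close>, which is why the map need not be injective and weights must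
  be added along it.\<close>

definition regroup ::
    "(nat \<times> 'x \<times> ('x \<Rightarrow> nat)) \<times> ('x \<Rightarrow> nat) \<Rightarrow> nat \<times> nat \<times> ('x \<Rightarrow> nat) \<times> ('x \<Rightarrow> nat)" where
  "regroup = (\<lambda>((i, x, \<phi>), \<psi>). (i, rep x, \<phi>, \<psi>))"

text \<open>The variable \<open>x\<close> lies in both scopes and witnesses that the two
  restrictions differ.\<close>

lemma regroup_closed:
  assumes "t \<in> cv_index" "\<psi> \<in> incons t"
  shows "regroup (t, \<psi>) \<in> cc_index"
proof -
  obtain i x \<phi> where t: "t = (i, x, \<phi>)" "i \<in> I" "x \<in> V i" "\<phi> \<in> allowed S i"
    "\<psi> \<in> allowed S (rep x)" "\<psi> x \<noteq> \<phi> x"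
    using assms by (auto simp: incons_def)
  have r: "rep x \<in> I" "x \<in> V (rep x)"
    using rep[OF t(2,3)] by auto
  have "restrict \<phi> (V i \<inter> V (rep x)) \<noteq> restrict \<psi> (V i \<inter> V (rep x))"
  proof
    assume "restrict \<phi> (V i \<inter> V (rep x)) = restrict \<psi> (V i \<inter> V (rep x))"
    then have "restrict \<phi> (V i \<inter> V (rep x)) x = restrict \<psi> (V i \<inter> V (rep x)) x"
      by (rule fun_cong)
    then show False
      using t r by simp
  qed
  then show ?thesis
    using t r by (simp add: regroup_def)
qed

lemma finite_incons: "t \<in> cv_index \<Longrightarrow> finite (incons t)"
  using rep finite_allowed by (auto simp: incons_def)

text \<open>The square of pq is first replaced by pq itself, then q is expanded over
  \<open>incons t\<close>, and finally every product of two projections is replaced by its own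
  square.\<close>

lemma img_square_le:
  assumes t: "t \<in> cv_index"
  shows "sos_tracial_le D (star D (img t) \<otimes>\<^bsub>D\<^esub> img t)
    (\<Oplus>\<^bsub>D\<^esub>\<psi>\<in>incons t. star D (cc_elem (regroup (t, \<psi>))) \<otimes>\<^bsub>D\<^esub> cc_elem (regroup (t, \<psi>)))"
proof -
  obtain i x \<phi> where t': "t = (i, x, \<phi>)" "i \<in> I" "x \<in> V i" "\<phi> \<in> allowed S i"
    using t by auto
  have r: "rep x \<in> I" "x \<in> V (rep x)"
    using rep[OF t'(2,3)] by auto
  have "\<phi> x < k"
    using allowed_subset[OF t'(2)] t'(3,4) by auto
  note q_eq = one_minus_spec_proj_unitary[OF t'(2,3) this]
  let ?q = "\<one>\<^bsub>D\<^esub> \<ominus>\<^bsub>D\<^esub> spec_proj D k (\<phi> x) (unitary x)"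
  let ?p = "cc_Phi k S i \<phi>"
  interpret p: star_projection D ?p
    using t'(2) by (rule star_projection_cc_Phi)
  interpret q: star_projection D ?q
    by (rule star_projection_one_minus_spec_proj)
  have elem: "cc_elem (regroup (t, \<psi>)) = ?p \<otimes>\<^bsub>D\<^esub> cc_Phi k S (rep x) \<psi>" for \<psi>
    by (simp add: regroup_def t')
  have psi: "star_projection D (cc_Phi k S (rep x) \<psi>)" for \<psi>
    using r(1) by (rule star_projection_cc_Phi)
  note psi_closed [simp] = star_projection.proj_closed[OF psi]
  have "?p \<otimes>\<^bsub>D\<^esub> ?q = (\<Oplus>\<^bsub>D\<^esub>\<psi>\<in>incons t. ?p \<otimes>\<^bsub>D\<^esub> cc_Phi k S (rep x) \<psi>)"
    unfolding q_eq using finite_incons[OF t]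
    by (subst D.finsum_rdistr) (auto simp: incons_def t')
  moreover have "sos_tracial_le D (\<Oplus>\<^bsub>D\<^esub>\<psi>\<in>incons t. ?p \<otimes>\<^bsub>D\<^esub> cc_Phi k S (rep x) \<psi>)
      (\<Oplus>\<^bsub>D\<^esub>\<psi>\<in>incons t. star D (cc_elem (regroup (t, \<psi>))) \<otimes>\<^bsub>D\<^esub> cc_elem (regroup (t, \<psi>)))"
    unfolding elem
    by (intro D.tracial_le_finsum finite_incons[OF t] D.projections_square_tracial_eq(2)
        p.star_projection_axioms psi) (simp_all add: D.star_closed)
  ultimately have "sos_tracial_le D (?p \<otimes>\<^bsub>D\<^esub> ?q)
      (\<Oplus>\<^bsub>D\<^esub>\<psi>\<in>incons t. star D (cc_elem (regroup (t, \<psi>))) \<otimes>\<^bsub>D\<^esub> cc_elem (regroup (t, \<psi>)))"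
    by simp
  with D.projections_square_tracial_eq(1)[OF p.star_projection_axioms q.star_projection_axioms]
  have "sos_tracial_le D (star D (?p \<otimes>\<^bsub>D\<^esub> ?q) \<otimes>\<^bsub>D\<^esub> (?p \<otimes>\<^bsub>D\<^esub> ?q))
      (\<Oplus>\<^bsub>D\<^esub>\<psi>\<in>incons t. star D (cc_elem (regroup (t, \<psi>))) \<otimes>\<^bsub>D\<^esub> cc_elem (regroup (t, \<psi>)))"
    by (rule D.tracial_le_trans[rotated 3]) (auto intro!: D.finsum_closed simp: elem D.star_closed)
  then show ?thesis
    by (simp add: t')
qed

lemma regrouped_weight_le:
  assumes P: "\<And>i j. i \<in> I \<Longrightarrow> j \<in> I \<Longrightarrow> V i \<inter> V j \<noteq> {} \<Longrightarrow> pmf \<pi>' i \<le> P * pmf \<pi> (i, j)"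
    and "0 \<le> P" and l: "l \<in> cc_index"
  shows "(\<Sum>m | m \<in> Sigma cv_index incons \<and> regroup m = l. cv_w (fst m)) \<le> P * cc_w l"
proof -
  obtain i j \<phi> \<psi> where l': "l = (i, j, \<phi>, \<psi>)" "i \<in> I" "j \<in> I"
    using l by auto
  define M where "M = {m. m \<in> Sigma cv_index incons \<and> regroup m = l}"
  \<comment> \<open>A member of the fibre over \<open>l\<close> is determined by its variable, the
    only datum that \<open>regroup\<close> discards.\<close>
  have M: "M \<subseteq> (\<lambda>x. ((i, x, \<phi>), \<psi>)) ` V i"
    by (auto simp: M_def l' regroup_def)
  have sum: "(\<Sum>m\<in>M. cv_w (fst m)) = real (card M) * (pmf \<pi>' i / real (card (V i)))"
  proof -
    have "(\<Sum>m\<in>M. cv_w (fst m)) = (\<Sum>m\<in>M. pmf \<pi>' i / real (card (V i)))"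
      using M by (intro sum.cong) auto
    then show ?thesis
      by simp
  qed
  have "(\<Sum>m\<in>M. cv_w (fst m)) \<le> P * pmf \<pi> (i, j)"
  \<comment> \<open>A nonempty fibre provides a variable common to both scopes, as the hypothesis
    \<open>P\<close> demands; an empty one has weight zero, and \<open>0 \<le> P\<close>
    suffices.\<close>
  proof (cases "M = {}")
    case True
    then show ?thesis
      using \<open>0 \<le> P\<close> by simp
  next
    case False
    then obtain x where x: "x \<in> V i" "((i, x, \<phi>), \<psi>) \<in> M"
      using M by auto
    then have "rep x = j"
      by (auto simp: M_def regroup_def l')
    then have "V i \<inter> V j \<noteq> {}"
      using rep[OF l'(2) x(1)] x(1) by auto
    have "card M \<le> card (V i)"
      using card_mono[OF finite_imageI M] card_image_le[of "V i"] finite_scope[OF l'(2)]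
      by (meson order_trans)
    moreover have "0 < card (V i)"
      using x(1) finite_scope[OF l'(2)] by (auto simp: card_gt_0_iff)
    ultimately have "real (card M) * (pmf \<pi>' i / real (card (V i))) \<le> pmf \<pi>' i"
      using mult_right_mono[of "real (card M)" "real (card (V i))" "pmf \<pi>' i"]
      by (simp add: field_simps)
    also have "\<dots> \<le> P * pmf \<pi> (i, j)"
      using l'(2,3) \<open>V i \<inter> V j \<noteq> {}\<close> by (rule P)
    finally show ?thesis
      unfolding sum .
  qed
  then show ?thesis
    unfolding M_def by (simp add: l'(1))
qed

lemma finite_regroup_domain: "finite (Sigma cv_index incons)"
  by (intro finite_SigmaI finite_cv_index finite_incons)

lemma regroup_funcset: "regroup \<in> Sigma cv_index incons \<rightarrow> cc_index"
proof
  fix m assume "m \<in> Sigma cv_index incons"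
  then show "regroup m \<in> cc_index"
    by (elim SigmaE) (simp only: regroup_closed)
qed

lemma regrouped_squares_le:
  assumes "\<And>i j. i \<in> I \<Longrightarrow> j \<in> I \<Longrightarrow> V i \<inter> V j \<noteq> {} \<Longrightarrow> pmf \<pi>' i \<le> P * pmf \<pi> (i, j)"
    and "0 \<le> P"
  shows "sos_tracial_le D
    (\<Oplus>\<^bsub>D\<^esub>m\<in>Sigma cv_index incons. complex_of_real (cv_w (fst m)) \<odot>\<^bsub>D\<^esub>
      (star D (cc_elem (regroup m)) \<otimes>\<^bsub>D\<^esub> cc_elem (regroup m)))
    (\<Oplus>\<^bsub>D\<^esub>l\<in>cc_index. complex_of_real (P * cc_w l) \<odot>\<^bsub>D\<^esub> (star D (cc_elem l) \<otimes>\<^bsub>D\<^esub> cc_elem l))"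
  using regrouped_weight_le[OF assms]
  by (intro D.tracial_le_regroup[OF finite_regroup_domain finite_cc_index regroup_funcset
        cc_elem_closed, of "\<lambda>m. cv_w (fst m)" "\<lambda>l. P * cc_w l"])

text \<open>The bound is stated without division, so that pairs with
  \<open>pmf \<pi> (i, j) = 0\<close> are covered as well.\<close>

lemma C_homomorphism_exists:
  assumes P: "\<And>i j. i \<in> I \<Longrightarrow> j \<in> I \<Longrightarrow> V i \<inter> V j \<noteq> {} \<Longrightarrow> pmf \<pi>' i \<le> P * pmf \<pi> (i, j)"
    and "0 \<le> P"
  shows "\<exists>\<beta>. C_homomorphism P (cv_alg k S) (cv_weight k S \<pi>') D (cc_weight k S \<pi>) \<beta>"
proof -
  obtain \<beta> where \<beta>: "\<beta> \<in> star_hom (cv_alg k S) D" "\<And>t. t \<in> cv_index \<Longrightarrow> \<beta> (cv_elem t) = img t"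
    using beta_exists by blast
  interpret C: star_algebra "cv_alg k S"
    by (rule cv_star_algebra)
  interpret \<beta>: star_alg_hom "cv_alg k S" D \<beta>
    by unfold_locales (rule \<beta>(1))
  note cc = D.weighted_star_algebra_listed_weight[OF finite_cc_index _ cc_elem_closed, of cc_w,
      folded cc_weight_def] D.weighted_squares_listed_weight[OF finite_cc_index _ cc_elem_closed, of cc_w,
      folded cc_weight_def]
  note cv = C.weighted_star_algebra_listed_weight[OF finite_cv_index _ cv_elem_closed, of cv_w,
      folded cv_weight_def] C.weighted_squares_listed_weight[OF finite_cv_index _ cv_elem_closed, of cv_w,
      folded cv_weight_def]
  let ?sq = "\<lambda>z. star D z \<otimes>\<^bsub>D\<^esub> z"
  let ?e = "\<lambda>t \<psi>. cc_elem (regroup (t, \<psi>))"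
  have e_closed: "?e t \<psi> \<in> carrier D" if "t \<in> cv_index" "\<psi> \<in> incons t" for t \<psi>
    using regroup_closed[OF that] cc_elem_closed by (rule funcset_mem[rotated])
  have img_closed': "img t \<in> carrier D" if "t \<in> cv_index" for t
    using img_closed that by (rule funcset_mem)
  have cv_w_nonneg: "0 \<le> cv_w t" and cc_w_nonneg: "0 \<le> cc_w l" for t l
    by (simp_all split: prod.split)
  have cc_closed: "cc_elem l \<in> carrier D" if "l \<in> cc_index" for l
    using cc_elem_closed that by (rule funcset_mem)
  let ?M = "Sigma cv_index incons"
  \<comment> \<open>The chain to be proved: \<open>?a\<close> is the image of the weighted squares,
    \<open>?b\<close> has each square expanded over \<open>incons\<close>, and \<open>?c\<close> is
    the target after regrouping.\<close>
  let ?a = "\<Oplus>\<^bsub>D\<^esub>t\<in>cv_index. complex_of_real (cv_w t) \<odot>\<^bsub>D\<^esub> ?sq (img t)"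
  let ?b = "\<Oplus>\<^bsub>D\<^esub>t\<in>cv_index. complex_of_real (cv_w t) \<odot>\<^bsub>D\<^esub> (\<Oplus>\<^bsub>D\<^esub>\<psi>\<in>incons t. ?sq (?e t \<psi>))"
  let ?c = "\<Oplus>\<^bsub>D\<^esub>l\<in>cc_index. complex_of_real (P * cc_w l) \<odot>\<^bsub>D\<^esub> ?sq (cc_elem l)"
  note closed = funcsetI D.smult_closed D.m_closed D.star_closed D.finsum_closed img_closed' e_closed
  have "\<beta> (weighted_squares (cv_alg k S) (cv_weight k S \<pi>')) = ?a"
  proof -
    have cv_closed: "cv_elem t \<in> carrier (cv_alg k S)" if "t \<in> cv_index" for t
      using cv_elem_closed that by (rule funcset_mem)
    have "\<beta> (weighted_squares (cv_alg k S) (cv_weight k S \<pi>')) =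
        (\<Oplus>\<^bsub>D\<^esub>t\<in>cv_index. \<beta> (complex_of_real (cv_w t) \<odot>\<^bsub>cv_alg k S\<^esub>
          (star (cv_alg k S) (cv_elem t) \<otimes>\<^bsub>cv_alg k S\<^esub> cv_elem t)))"
      unfolding cv(2)[OF cv_w_nonneg]
      by (rule \<beta>.hom_finsum) (intro funcsetI C.smult_closed C.m_closed C.star_closed cv_closed)
    also have "\<dots> = ?a"
    proof (rule D.finsum_cong')
      fix t assume t: "t \<in> cv_index"
      show "\<beta> (complex_of_real (cv_w t) \<odot>\<^bsub>cv_alg k S\<^esub>
          (star (cv_alg k S) (cv_elem t) \<otimes>\<^bsub>cv_alg k S\<^esub> cv_elem t)) =
        complex_of_real (cv_w t) \<odot>\<^bsub>D\<^esub> ?sq (img t)"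
        unfolding \<beta>(2)[OF t, symmetric]
        using cv_closed[OF t]
        by (simp only: \<beta>.hom_smult \<beta>.hom_mult \<beta>.hom_star C.m_closed C.star_closed)
    qed (rule refl, intro closed)
    finally show ?thesis .
  qed
  moreover have "sos_tracial_le D ?a ?b"
    by (intro D.tracial_le_finsum finite_cv_index D.tracial_le_smult cv_w_nonneg img_square_le closed)
  moreover have "sos_tracial_le D ?b ?c"
  proof -
    have "?b = (\<Oplus>\<^bsub>D\<^esub>t\<in>cv_index. \<Oplus>\<^bsub>D\<^esub>\<psi>\<in>incons t. complex_of_real (cv_w t) \<odot>\<^bsub>D\<^esub> ?sq (?e t \<psi>))"
      by (rule D.finsum_cong'[OF refl _ D.smult_finsum]) (intro closed; assumption)+
    also have "\<dots> = (\<Oplus>\<^bsub>D\<^esub>m\<in>?M. case_prod (\<lambda>t \<psi>. complex_of_real (cv_w t) \<odot>\<^bsub>D\<^esub> ?sq (?e t \<psi>)) m)"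
      by (intro D.finsum_Sigma finite_cv_index finite_incons closed)
    also have "\<dots> = (\<Oplus>\<^bsub>D\<^esub>m\<in>?M. complex_of_real (cv_w (fst m)) \<odot>\<^bsub>D\<^esub> ?sq (cc_elem (regroup m)))"
      by (simp only: case_prod_beta prod.collapse)
    finally have b_eq: "?b = \<dots>" .
    show ?thesis
      unfolding b_eq using P \<open>0 \<le> P\<close> by (rule regrouped_squares_le)
  qed
  moreover have "?c = complex_of_real P \<odot>\<^bsub>D\<^esub> weighted_squares D (cc_weight k S \<pi>)"
  proof -
    have "?c = (\<Oplus>\<^bsub>D\<^esub>l\<in>cc_index. complex_of_real P \<odot>\<^bsub>D\<^esub> (complex_of_real (cc_w l) \<odot>\<^bsub>D\<^esub> ?sq (cc_elem l)))"
    proof (rule D.finsum_cong'[OF refl])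
      fix l assume "l \<in> cc_index"
      then have "?sq (cc_elem l) \<in> carrier D"
        by (intro closed cc_closed)
      then show "complex_of_real (P * cc_w l) \<odot>\<^bsub>D\<^esub> ?sq (cc_elem l) =
          complex_of_real P \<odot>\<^bsub>D\<^esub> (complex_of_real (cc_w l) \<odot>\<^bsub>D\<^esub> ?sq (cc_elem l))"
        by (simp only: of_real_mult D.smult_assoc)
    qed (intro closed cc_closed)
    also have "\<dots> = complex_of_real P \<odot>\<^bsub>D\<^esub> weighted_squares D (cc_weight k S \<pi>)"
      unfolding cc(2)[OF cc_w_nonneg] by (rule D.smult_finsum[symmetric]) (intro closed cc_closed)
    finally show ?thesis .
  qed
  moreover have "?a \<in> carrier D"
    by (intro closed)
  moreover have "?b \<in> carrier D"
    by (intro closed)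
  moreover have "?c \<in> carrier D"
    by (intro closed cc_closed)
  ultimately have "sos_tracial_le D (\<beta> (weighted_squares (cv_alg k S) (cv_weight k S \<pi>')))
      (complex_of_real P \<odot>\<^bsub>D\<^esub> weighted_squares D (cc_weight k S \<pi>))"
    using D.tracial_le_trans[of ?a ?b ?c] by (simp only:)
  with \<beta>(1) cc(1)[OF cc_w_nonneg] cv(1)[OF cv_w_nonneg] show ?thesis
    unfolding C_homomorphism_def by blast
qed

end

theorem lemma3p8:
  fixes k :: nat and S :: "'x csystem"
    and \<pi> :: "(nat \<times> nat) pmf" and \<pi>' :: "nat pmf" and P :: ennreal
  assumes "constraint_system k S"
    and "set_pmf \<pi> \<subseteq> {1..num S} \<times> {1..num S}"
    and "\<And>i. pmf \<pi>' i = (\<Sum>j\<in>{1..num S}. pmf \<pi> (i, j))"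
    and "P = cc_cv_constant S \<pi> \<pi>'"
    and "P < \<infinity>"
  shows "\<exists>\<beta>. C_homomorphism (enn2real P)
           (cv_alg k S) (cv_weight k S \<pi>') (cc_alg k S) (cc_weight k S \<pi>) \<beta>"
proof -
  interpret constraint_system_data k S \<pi> \<pi>'
    by unfold_locales fact
  show ?thesis
  proof (rule C_homomorphism_exists)
    fix i j assume "i \<in> {1..num S}" "j \<in> {1..num S}" "scope S i \<inter> scope S j \<noteq> {}"
    then have le: "ennreal (pmf \<pi>' i) / ennreal (pmf \<pi> (i, j)) \<le> P"
      unfolding assms(4) cc_cv_constant_def by (intro SUP_upper2[of "(i, j)"]) auto
    show "pmf \<pi>' i \<le> enn2real P * pmf \<pi> (i, j)"
    \<comment> \<open>With a vanishing denominator the quotient is infinite unless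
      \<open>pmf \<pi>' i\<close> vanishes too; as \<open>P\<close> is finite, both sides of the
      claim are then zero.\<close>
    proof (cases "pmf \<pi> (i, j) = 0")
      case True
      have "pmf \<pi>' i = 0"
      proof (rule ccontr)
        assume "pmf \<pi>' i \<noteq> 0"
        then have "0 < pmf \<pi>' i"
          by (simp add: less_le)
        then have "ennreal (pmf \<pi>' i) / ennreal (pmf \<pi> (i, j)) = \<infinity>"
          using True by (simp add: ennreal_divide_eq_top_iff)
        with le assms(5) show False
          by simp
      qed
      then show ?thesis
        using True by simp
    next
      case False
      then have pos: "0 < pmf \<pi> (i, j)"
        using pmf_nonneg[of \<pi> "(i, j)"] by simp
      have "ennreal (pmf \<pi>' i / pmf \<pi> (i, j)) \<le> P"
        using le pos by (simp add: divide_ennreal)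
      \<comment> \<open>Finiteness of \<open>P\<close> is essential for the passage to real numbers,
        because \<open>enn2real\<close> sends infinity to zero.\<close>
      then have "pmf \<pi>' i / pmf \<pi> (i, j) \<le> enn2real P"
        using enn2real_mono[of "ennreal (pmf \<pi>' i / pmf \<pi> (i, j))" P] assms(5) pos by simp
      then show ?thesis
        using pos by (simp add: field_simps)
    qed
  qed simp
qed

end
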